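(* Let $A$ and $B$ be finite dimensional full algebras over an algebraically closed field $F$ of characteristic zero. If $A$ and $B$ are PI-equivalent (i.e. $\mathrm{Id}(A)=\mathrm{Id}(B)$), then their maximal semisimple subalgebras $A_{ss}$ and $B_{ss}$ are isomorphic. In particular this holds when $A$ and $B$ are fundamental algebras.
   Context: For a finite dimensional algebra $A$ let $A\cong A_1\times\cdots\times A_q\oplus J_A$ be its Wedderburn–Malcev decomposition, with $A_i$ simple and $J_A$ the Jacobson radical. $A$ is called full if, up to a permutation of the simple components, $A_1\cdot J_A\cdot A_2\cdots J_A\cdot A_q\neq 0$. Fundamental algebras (in the sense of Kemer's theory) are a special type of full algebras. *)

theory Defs
  imports Main "HOL-Computational_Algebra.Polynomial"
begin

text \<open>An F-algebra is a type of class ring (associative, not necessarily unital)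
  together with a scalar multiplication sm making it an F-vector space such
  that the multiplication is F-bilinear. The whole type is the algebra.\<close>

definition is_algebra :: "('k::field \<Rightarrow> 'a::ring \<Rightarrow> 'a) \<Rightarrow> bool" where
  "is_algebra sm \<longleftrightarrow> vector_space sm \<and>
     (\<forall>c x y. sm c (x * y) = sm c x * y \<and> sm c (x * y) = x * sm c y)"

definition fd_algebra :: "('k::field \<Rightarrow> 'a::ring \<Rightarrow> 'a) \<Rightarrow> bool" where
  "fd_algebra sm \<longleftrightarrow> is_algebra sm \<and> (\<exists>B. finite B \<and> module.span sm B = UNIV)"

definition subalg :: "('k::field \<Rightarrow> 'a::ring \<Rightarrow> 'a) \<Rightarrow> 'a set \<Rightarrow> bool" where
  "subalg sm S \<longleftrightarrow> module.subspace sm S \<and> (\<forall>x\<in>S. \<forall>y\<in>S. x * y \<in> S)"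

definition ideal_in :: "('k::field \<Rightarrow> 'a::ring \<Rightarrow> 'a) \<Rightarrow> 'a set \<Rightarrow> 'a set \<Rightarrow> bool" where
  "ideal_in sm R I \<longleftrightarrow> module.subspace sm I \<and> I \<subseteq> R \<and>
     (\<forall>r\<in>R. \<forall>x\<in>I. r * x \<in> I \<and> x * r \<in> I)"

fun prodw :: "(nat \<Rightarrow> 'a::ring) \<Rightarrow> nat list \<Rightarrow> 'a" where
  "prodw x [] = 0"
| "prodw x [i] = x i"
| "prodw x (i # j # w) = x i * prodw x (j # w)"

definition nilpotent_set :: "'a::ring set \<Rightarrow> bool" where
  "nilpotent_set I \<longleftrightarrow> (\<exists>n\<ge>1. \<forall>x. (\<forall>i<n. x i \<in> I) \<longrightarrow> prodw x [0..<n] = 0)"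

text \<open>Jacobson radical of a finite dimensional algebra = its largest nilpotent ideal.\<close>
definition jac :: "('k::field \<Rightarrow> 'a::ring \<Rightarrow> 'a) \<Rightarrow> 'a set" where
  "jac sm = (THE J. ideal_in sm UNIV J \<and> nilpotent_set J \<and>
       (\<forall>I. ideal_in sm UNIV I \<and> nilpotent_set I \<longrightarrow> I \<subseteq> J))"

definition simple_alg :: "('k::field \<Rightarrow> 'a::ring \<Rightarrow> 'a) \<Rightarrow> 'a set \<Rightarrow> bool" where
  "simple_alg sm R \<longleftrightarrow> subalg sm R \<and> (\<exists>x\<in>R. \<exists>y\<in>R. x * y \<noteq> 0) \<and>
     (\<forall>I. ideal_in sm R I \<longrightarrow> I = {0} \<or> I = R)"

definition wm_decomp :: "('k::field \<Rightarrow> 'a::ring \<Rightarrow> 'a) \<Rightarrow> 'a set \<Rightarrow> nat \<Rightarrow> (nat \<Rightarrow> 'a set) \<Rightarrow> bool" where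
  "wm_decomp sm S q C \<longleftrightarrow>
     subalg sm S \<and> S \<inter> jac sm = {0} \<and> (\<forall>a. \<exists>s\<in>S. \<exists>j\<in>jac sm. a = s + j) \<and>
     (\<forall>i<q. simple_alg sm (C i)) \<and>
     (\<forall>i<q. \<forall>k<q. i \<noteq> k \<longrightarrow> (\<forall>x\<in>C i. \<forall>y\<in>C k. x * y = 0)) \<and>
     (\<forall>c. (\<forall>i<q. c i \<in> C i) \<longrightarrow> (\<Sum>i<q. c i) \<in> S) \<and>
     (\<forall>s\<in>S. \<exists>!c. (\<forall>i<q. c i \<in> C i) \<and> (\<forall>i\<ge>q. c i = 0) \<and> s = (\<Sum>i<q. c i))"

fun jprod :: "(nat \<Rightarrow> 'a::ring) \<Rightarrow> (nat \<Rightarrow> 'a) \<Rightarrow> nat \<Rightarrow> 'a" where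
  "jprod a j 0 = 0"
| "jprod a j (Suc 0) = a 0"
| "jprod a j (Suc (Suc n)) = jprod a j (Suc n) * j n * a (Suc n)"

text \<open>Full algebra: for some Wedderburn--Malcev decomposition and some ordering of
  the simple components, A_1 J A_2 ... J A_q \<noteq> 0 (this product of subspaces is
  spanned by the products of elements, so it is nonzero iff one such product is).\<close>
definition full_alg :: "('k::field \<Rightarrow> 'a::ring \<Rightarrow> 'a) \<Rightarrow> bool" where
  "full_alg sm \<longleftrightarrow> (\<exists>S q C. wm_decomp sm S q C \<and> q \<ge> 1 \<and>
     (\<exists>a j. (\<forall>i<q. a i \<in> C i) \<and> (\<forall>i. j i \<in> jac sm) \<and> jprod a j q \<noteq> 0))"

text \<open>Noncommutative polynomials in variables x_0, x_1, ... over F: finitely supported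
  coefficient functions on words (lists of variable indices). Evaluation in A.\<close>
definition peval :: "('k::field \<Rightarrow> 'a::ring \<Rightarrow> 'a) \<Rightarrow> (nat list \<Rightarrow> 'k) \<Rightarrow> (nat \<Rightarrow> 'a) \<Rightarrow> 'a" where
  "peval sm f x = (\<Sum>w\<in>{w. f w \<noteq> 0}. sm (f w) (prodw x w))"

definition PI_Id :: "('k::field \<Rightarrow> 'a::ring \<Rightarrow> 'a) \<Rightarrow> (nat list \<Rightarrow> 'k) set" where
  "PI_Id sm = {f. finite {w. f w \<noteq> 0} \<and> f [] = 0 \<and> (\<forall>x. peval sm f x = 0)}"

definition alg_iso_on :: "('k::field \<Rightarrow> 'a::ring \<Rightarrow> 'a) \<Rightarrow> ('k \<Rightarrow> 'b::ring \<Rightarrow> 'b) \<Rightarrow>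
    'a set \<Rightarrow> 'b set \<Rightarrow> ('a \<Rightarrow> 'b) \<Rightarrow> bool" where
  "alg_iso_on sa sb S T \<phi> \<longleftrightarrow> bij_betw \<phi> S T \<and>
     (\<forall>x\<in>S. \<forall>y\<in>S. \<phi> (x + y) = \<phi> x + \<phi> y \<and> \<phi> (x * y) = \<phi> x * \<phi> y) \<and>
     (\<forall>c. \<forall>x\<in>S. \<phi> (sa c x) = sb c (\<phi> x))"

definition alg_closed_field :: "'k::field itself \<Rightarrow> bool" where
  "alg_closed_field _ \<longleftrightarrow> (\<forall>p :: 'k poly. degree p \<noteq> 0 \<longrightarrow> (\<exists>z. poly p z = 0))"

end

theory Submission
  imports Defs "HOL-Combinatorics.Permutations" "HOL-Library.Countable"
begin

text \<open>
  Over an algebraically closed field the simple components of \<open>A\<close> are matrix algebras of sizes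
  \<open>n\<^sub>1, \<dots>, n\<^sub>q\<close>, and those of \<open>B\<close> have sizes \<open>m\<^sub>1, \<dots>, m\<^sub>q\<^sub>'\<close>. For each \<open>i\<close> take \<open>N\<close> consecutive
  segments, the \<open>k\<close>-th of which contains \<open>n\<^sub>i\<^sup>2\<close> designated variables; join the groups belonging to
  different \<open>i\<close> by link variables, and for each \<open>k\<close> alternate the designated variables of all
  \<open>k\<close>-th segments simultaneously. Evaluating at matrix units shows, \<open>A\<close> being full, that this
  polynomial is not an identity of \<open>A\<close>, hence not of \<open>B\<close>.

  Choose \<open>N\<close> with \<open>J\<^sup>N = 0\<close> for the radical \<open>J\<close> of \<open>B\<close>. In a nonzero value on \<open>B\<close> with arguments that
  are matrix units or radical elements, some \<open>k\<close> involves no radical element. Each \<open>k\<close>-th segment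
  then lies in one simple component of \<open>B\<close>, indexed \<open>h i\<close>, and by alternation the designated variables
  have distinct values, so the \<open>n\<^sub>i\<^sup>2\<close> with \<open>h i = j\<close> add up to at most \<open>m\<^sub>j\<^sup>2\<close>. Exchanging the roles of
  \<open>A\<close> and \<open>B\<close> forces equality everywhere, so \<open>h\<close> is a size preserving bijection between the
  components.
\<close>

section \<open>Products of lists in a ring without unit\<close>

text \<open>There is no unit, so the empty product gets the dummy value \<open>0\<close>, matching
  \<open>prodw\<close>. Splitting a product therefore requires nonempty parts.\<close>

fun prodl :: "'a::ring list \<Rightarrow> 'a" where
  "prodl [] = 0"
| "prodl [x] = x"
| "prodl (x # y # zs) = x * prodl (y # zs)"

lemma prodl_Cons: "xs \<noteq> [] \<Longrightarrow> prodl (x # xs) = x * prodl xs"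
  by (cases xs) auto

lemma prodw_eq_prodl: "prodw x w = prodl (map x w)"
  by (induction x w rule: prodw.induct) auto

lemma prodl_append: "xs \<noteq> [] \<Longrightarrow> ys \<noteq> [] \<Longrightarrow> prodl (xs @ ys) = prodl xs * prodl ys"
proof (induction xs)
  case (Cons x xs)
  then show ?case by (cases "xs = []") (auto simp: prodl_Cons mult.assoc)
qed simp

lemma prodl_sublist_zero:
  assumes "ys \<noteq> []" "prodl ys = 0"
  shows "prodl (xs @ ys @ zs) = 0"
proof -
  have "prodl (ys @ zs) = 0"
    using assms by (cases "zs = []") (auto simp: prodl_append)
  then show ?thesis
    using assms by (cases "xs = []") (auto simp: prodl_append)
qed

lemma nilpotent_set_iff:
  "nilpotent_set I \<longleftrightarrow> (\<exists>n\<ge>1. \<forall>xs. length xs = n \<and> set xs \<subseteq> I \<longrightarrow> prodl xs = 0)"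
proof -
  have "(\<forall>x. (\<forall>i<n. x i \<in> I) \<longrightarrow> prodw x [0..<n] = 0) \<longleftrightarrow>
        (\<forall>xs. length xs = n \<and> set xs \<subseteq> I \<longrightarrow> prodl xs = 0)" for n
  proof safe
    fix xs assume *: "\<forall>x. (\<forall>i<length xs. x i \<in> I) \<longrightarrow> prodw x [0..<length xs] = 0" "set xs \<subseteq> I"
    then have "prodw ((!) xs) [0..<length xs] = 0" by (auto simp: subset_iff)
    then show "prodl xs = 0" by (simp add: prodw_eq_prodl map_nth)
  next
    fix x assume *: "\<forall>xs. length xs = n \<and> set xs \<subseteq> I \<longrightarrow> prodl xs = 0" "\<forall>i<n. x i \<in> I"
    have "prodl (map x [0..<n]) = 0" using * by (intro *(1)[rule_format]) auto
    then show "prodw x [0..<n] = 0" by (simp add: prodw_eq_prodl)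
  qed
  then show ?thesis unfolding nilpotent_set_def by simp
qed

section \<open>Finite-dimensional algebras and their radical\<close>

locale algebra = vector_space sm for sm :: "'k::field \<Rightarrow> 'a::ring \<Rightarrow> 'a" +
  assumes scale_mult_left: "sm c x * y = sm c (x * y)"
    and scale_mult_right: "x * sm c y = sm c (x * y)"

locale fin_dim_algebra = algebra sm + finite_dimensional_vector_space sm Basis
  for sm :: "'k::field \<Rightarrow> 'a::ring \<Rightarrow> 'a" and Basis

lemma fd_algebra_imp_fin_dim_algebra:
  assumes "fd_algebra sm"
  shows "\<exists>Basis. fin_dim_algebra sm Basis"
proof -
  from assms interpret algebra sm
    unfolding fd_algebra_def is_algebra_def algebra_def algebra_axioms_def by metis
  from assms obtain B where B: "finite B" "span B = UNIV"
    unfolding fd_algebra_def by auto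
  obtain C where C: "C \<subseteq> B" "independent C" "B \<subseteq> span C"
    using maximal_independent_subset[of B] by blast
  then have "span C = UNIV"
    by (metis B(2) span_minimal subspace_span top.extremum_uniqueI)
  with C B have "fin_dim_algebra sm C"
    by unfold_locales (auto intro: finite_subset)
  then show ?thesis by blast
qed

section \<open>Products with many factors in a nilpotent ideal, and sums of nilpotent ideals\<close>

context algebra
begin

lemma prodl_mem_ideal:
  assumes "ideal_in sm UNIV I" "set xs \<inter> I \<noteq> {}"
  shows "prodl xs \<in> I"
  using assms(2)
proof (induction xs)
  case (Cons x xs)
  with assms(1) show ?case
    by (cases "xs = []") (auto simp: prodl_Cons ideal_in_def)
qed simp

text \<open>A factor outside \<open>I\<close> is absorbed into the next entry, which stays in the
  ideal; the last of the \<open>n\<close> entries swallows the entire remaining product.\<close>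

lemma prodl_regroup:
  assumes I: "ideal_in sm UNIV I"
  shows "1 \<le> n \<Longrightarrow> n \<le> length (filter (\<lambda>x. x \<in> I) xs) \<Longrightarrow>
    \<exists>ys. length ys = n \<and> set ys \<subseteq> I \<and> prodl ys = prodl xs"
proof (induction xs arbitrary: n)
  case (Cons x xs)
  show ?case
  proof (cases "n = 1")
    case True
    from Cons.prems have "filter (\<lambda>x. x \<in> I) (x # xs) \<noteq> []" by force
    then have "set (x # xs) \<inter> I \<noteq> {}" unfolding filter_empty_conv by blast
    then have "prodl (x # xs) \<in> I" by (rule prodl_mem_ideal[OF I])
    with True show ?thesis by (intro exI[of _ "[prodl (x # xs)]"]) simp
  next
    case False
    with Cons.prems have n: "n \<ge> 2" by simp
    with Cons.prems have "xs \<noteq> []" by (auto split: if_splits)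
    show ?thesis
    proof (cases "x \<in> I")
      case True
      with Cons.prems n have "1 \<le> n - 1" "n - 1 \<le> length (filter (\<lambda>x. x \<in> I) xs)" by auto
      from Cons.IH[OF this] obtain ys
        where "length ys = n - 1" "set ys \<subseteq> I" "prodl ys = prodl xs" by blast
      moreover from this n have "ys \<noteq> []" by auto
      ultimately show ?thesis using n True \<open>xs \<noteq> []\<close>
        by (intro exI[of _ "x # ys"]) (auto simp: prodl_Cons)
    next
      case False
      with Cons.prems Cons.IH[of n] obtain ys
        where ys: "length ys = n" "set ys \<subseteq> I" "prodl ys = prodl xs" by auto
      then obtain y zs where "ys = y # zs" "zs \<noteq> []" using n
        by (cases ys; cases "tl ys") auto
      with ys I n \<open>xs \<noteq> []\<close> show ?thesis
        by (intro exI[of _ "(x * y) # zs"]) (auto simp: prodl_Cons ideal_in_def mult.assoc)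
    qed
  qed
qed simp

text \<open>The factors from \<open>I\<close> count wherever they stand in the product, not only in
  a consecutive run. This is the form of nilpotency applied to the test word.\<close>

lemma prodl_nilpotent:
  assumes "ideal_in sm UNIV I" "nilpotent_set I"
  obtains n where "n \<ge> 1" "\<And>xs. n \<le> length (filter (\<lambda>x. x \<in> I) xs) \<Longrightarrow> prodl xs = 0"
proof -
  from assms(2) obtain n where n: "n \<ge> 1" "\<And>xs. length xs = n \<Longrightarrow> set xs \<subseteq> I \<Longrightarrow> prodl xs = 0"
    unfolding nilpotent_set_iff by auto
  show ?thesis
    using that[OF n(1)] prodl_regroup[OF assms(1) n(1)] n(2) by metis
qed

lemma ideal_in_sum:
  assumes "ideal_in sm UNIV I" "ideal_in sm UNIV J"
  shows "ideal_in sm UNIV {x + y |x y. x \<in> I \<and> y \<in> J}"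
  using assms subspace_sums[of I J]
  unfolding ideal_in_def by (fastforce simp: distrib_left distrib_right)

text \<open>Congruence modulo \<open>J\<close> is respected factor by factor, by
  \<open>z * c - x * d = (z - x) * c + x * (c - d)\<close>.\<close>

lemma prodl_add_ideal:
  assumes J: "ideal_in sm UNIV J"
    and "list_all2 (\<lambda>z x. z - x \<in> J) zs xs"
  shows "prodl zs - prodl xs \<in> J"
  using assms(2)
proof (induction zs xs rule: list_all2_induct)
  case Nil
  then show ?case using J by (simp add: ideal_in_def subspace_0)
next
  case (Cons z zs x xs)
  show ?case
  proof (cases "xs = []")
    case True
    with Cons show ?thesis by simp
  next
    case False
    with Cons have "zs \<noteq> []" by auto
    have "prodl (z # zs) - prodl (x # xs) = (z - x) * prodl zs + x * (prodl zs - prodl xs)"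
      using False \<open>zs \<noteq> []\<close> by (simp add: prodl_Cons algebra_simps)
    with J Cons show ?thesis by (auto simp: ideal_in_def subspace_add)
  qed
qed

text \<open>Modulo \<open>J\<close>, a product of \<open>m\<close> elements of the sum is a product
  of \<open>m\<close> elements of \<open>I\<close>, hence zero, so the product itself lies in
  \<open>J\<close>. A product of \<open>n\<close> such chunks then vanishes.\<close>

lemma nilpotent_set_sum:
  assumes I: "ideal_in sm UNIV I" "nilpotent_set I" and J: "ideal_in sm UNIV J" "nilpotent_set J"
  shows "nilpotent_set {x + y |x y. x \<in> I \<and> y \<in> J}" (is "nilpotent_set ?S")
proof -
  from I(2) obtain m where m: "m \<ge> 1" "\<And>xs. length xs = m \<Longrightarrow> set xs \<subseteq> I \<Longrightarrow> prodl xs = 0"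
    unfolding nilpotent_set_iff by auto
  from J(2) obtain n where n: "n \<ge> 1" "\<And>xs. length xs = n \<Longrightarrow> set xs \<subseteq> J \<Longrightarrow> prodl xs = 0"
    unfolding nilpotent_set_iff by auto
  have inJ: "prodl zs \<in> J" if zs: "length zs = m" "set zs \<subseteq> ?S" for zs
  proof -
    have "\<forall>z\<in>set zs. \<exists>x\<in>I. z - x \<in> J" using zs(2) by (force simp: subset_iff)
    then obtain f where f: "\<And>z. z \<in> set zs \<Longrightarrow> f z \<in> I \<and> z - f z \<in> J" by metis
    have "prodl zs - prodl (map f zs) \<in> J"
      using f by (intro prodl_add_ideal[OF J(1)]) (auto simp: list_all2_conv_all_nth)
    moreover have "prodl (map f zs) = 0" using f zs by (intro m) auto
    ultimately show ?thesis by simp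
  qed
  have chunks: "\<exists>ys. length ys = k \<and> set ys \<subseteq> J \<and> prodl ys = prodl zs"
    if "length zs = k * m" "set zs \<subseteq> ?S" for k zs
    using that
  proof (induction k arbitrary: zs)
    case (Suc k)
    let ?a = "take m zs" and ?b = "drop m zs"
    from Suc.prems have a: "length ?a = m" "set ?a \<subseteq> ?S"
      by (auto dest: in_set_takeD)
    from Suc.prems have b: "length ?b = k * m" "set ?b \<subseteq> ?S"
      by (auto dest: in_set_dropD)
    from Suc.IH[OF b] obtain ys where ys: "length ys = k" "set ys \<subseteq> J" "prodl ys = prodl ?b"
      by blast
    have "prodl (prodl ?a # ys) = prodl (?a @ ?b)"
    proof (cases "k = 0")
      case False
      then have "ys \<noteq> []" "?b \<noteq> []" "?a \<noteq> []" using ys b a m(1) by force+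
      then show ?thesis by (metis prodl_Cons prodl_append ys(3))
    qed (use ys b in auto)
    with ys inJ[OF a] show ?case by (intro exI[of _ "prodl ?a # ys"]) auto
  qed simp
  have "prodl zs = 0" if "length zs = n * m" "set zs \<subseteq> ?S" for zs
    using chunks[OF that] n(2) by metis
  then show ?thesis unfolding nilpotent_set_iff using m(1) n(1)
    by (intro exI[of _ "n * m"]) auto
qed

end

context fin_dim_algebra
begin

text \<open>The description in \<open>jac\<close> denotes something: a nilpotent ideal of largest
  dimension contains every other one, because their sum is again nilpotent.\<close>

lemma jac_nilpotent_ideal: "ideal_in sm UNIV (jac sm) \<and> nilpotent_set (jac sm)"
proof -
  define N where "N = {I. ideal_in sm UNIV I \<and> nilpotent_set I}"
  have "ideal_in sm UNIV {0}" unfolding ideal_in_def by auto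
  moreover have "nilpotent_set ({0}::'a set)"
    unfolding nilpotent_set_iff by (intro exI[of _ 1]) (auto simp: length_Suc_conv)
  ultimately have "{0} \<in> N" by (simp add: N_def)
  moreover have "\<forall>I. I \<in> N \<longrightarrow> dim I < Suc dimension"
    by (simp add: dim_subset_UNIV less_Suc_eq_le)
  ultimately obtain J where J: "J \<in> N" "\<And>I. I \<in> N \<Longrightarrow> dim I \<le> dim J"
    using ex_has_greatest_nat[of "\<lambda>I. I \<in> N" "{0}" dim] by blast
  have max: "I \<subseteq> J" if "I \<in> N" for I
  proof -
    let ?S = "{x + y |x y. x \<in> I \<and> y \<in> J}"
    have S: "?S \<in> N" using J(1) that ideal_in_sum nilpotent_set_sum unfolding N_def by simp
    have sub: "subspace I" "subspace J" "subspace ?S"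
      using J(1) that S unfolding N_def ideal_in_def by auto
    have "J \<subseteq> ?S" using subspace_0[OF sub(1)] by force
    then have "J = ?S" using subspace_dim_equal[OF sub(2,3)] J(2)[OF S] by blast
    moreover have "I \<subseteq> ?S" using subspace_0[OF sub(2)] by force
    ultimately show ?thesis by simp
  qed
  have "jac sm \<in> N \<and> (\<forall>I\<in>N. I \<subseteq> jac sm)"
    unfolding jac_def
    by (rule theI2[of _ J]) (use J(1) max in \<open>auto simp: N_def\<close>)
  then show ?thesis by (simp add: N_def)
qed

end

section \<open>Simple algebras over an algebraically closed field\<close>

context algebra
begin

text \<open>The vector \<open>p(f) v\<close>, computed by Horner's rule.\<close>

definition poly_act :: "('a \<Rightarrow> 'a) \<Rightarrow> 'a \<Rightarrow> 'k poly \<Rightarrow> 'a" where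
  "poly_act f v p = fold_coeffs (\<lambda>a y. sm a v + f y) p 0"

lemma poly_act_pCons:
  assumes "f 0 = 0"
  shows "poly_act f v (pCons a p) = sm a v + f (poly_act f v p)"
  using assms by (cases "p = 0 \<and> a = 0") (auto simp: poly_act_def)

lemma poly_act_0 [simp]: "poly_act f v 0 = 0"
  by (simp add: poly_act_def)

end

text \<open>Linearity is asked on \<open>L\<close> only, because the map to which Schur's lemma is
  applied is built by choice and is controlled only there.\<close>

locale endomorphism_on = algebra sm for sm :: "'k::field \<Rightarrow> 'a::ring \<Rightarrow> 'a" +
  fixes L :: "'a set" and f :: "'a \<Rightarrow> 'a"
  assumes L: "subspace L"
    and f_closed: "x \<in> L \<Longrightarrow> f x \<in> L"
    and f_add: "x \<in> L \<Longrightarrow> y \<in> L \<Longrightarrow> f (x + y) = f x + f y"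
    and f_scale: "x \<in> L \<Longrightarrow> f (sm c x) = sm c (f x)"
begin

lemma f_0: "f 0 = 0"
  using f_scale[of 0 0] subspace_0[OF L] by simp

lemma poly_act_closed: "v \<in> L \<Longrightarrow> poly_act f v p \<in> L"
  by (induction p) (auto simp: poly_act_pCons f_0 L subspace_0 subspace_add subspace_scale f_closed)

lemma poly_act_add:
  assumes "v \<in> L"
  shows "poly_act f v (p + q) = poly_act f v p + poly_act f v q"
  by (induction p q rule: poly_induct2)
    (auto simp: poly_act_pCons f_0 f_add poly_act_closed assms algebra_simps scale_left_distrib)

lemma poly_act_smult:
  assumes "v \<in> L"
  shows "poly_act f v (smult c p) = sm c (poly_act f v p)"
  by (induction p)
    (auto simp: poly_act_pCons f_0 f_scale poly_act_closed assms scale_right_distrib)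

lemma poly_act_sum:
  assumes "v \<in> L"
  shows "poly_act f v (\<Sum>i\<in>A. p i) = (\<Sum>i\<in>A. poly_act f v (p i))"
  by (induction A rule: infinite_finite_induct) (auto simp: poly_act_add assms)

end

text \<open>The vectors obtained from \<open>v\<close> by applying \<open>f\<close> up to
  \<open>dimension\<close> times are linearly dependent, so a nonzero polynomial kills
  \<open>v\<close>. Take one of least degree and split off a root \<open>z\<close>: the cofactor
  \<open>q\<close> does not kill \<open>v\<close>, and \<open>q(f) v\<close> is an eigenvector for
  \<open>z\<close>.\<close>

lemma (in fin_dim_algebra) eigenvector_exists:
  assumes ac: "alg_closed_field TYPE('k)" and "endomorphism_on sm L f"
    and v: "v \<in> L" "v \<noteq> 0"
  shows "\<exists>z. \<exists>x\<in>L. x \<noteq> 0 \<and> f x = sm z x"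
proof -
  interpret endomorphism_on sm L f by fact
  note [simp] = poly_act_add[OF v(1)] poly_act_smult[OF v(1)]
  let ?w = "\<lambda>i. poly_act f v (monom 1 i)"
  have "\<exists>p. p \<noteq> 0 \<and> poly_act f v p = 0"
  \<comment> \<open>Dependence is a property of sets, so a repetition among the \<open>?w i\<close>
    would be lost in the image; it gives a relation of its own.\<close>
  proof (cases "inj_on ?w {..dimension}")
    case False
    then obtain i j where ij: "i \<noteq> j" "?w i = ?w j" unfolding inj_on_def by blast
    let ?p = "monom 1 i + smult (-1) (monom 1 j) :: 'k poly"
    have "poly_act f v ?p = 0" by (simp only: poly_act_add[OF v(1)] poly_act_smult[OF v(1)] ij) simp
    moreover have "coeff ?p i = 1" using ij by simp
    then have "?p \<noteq> 0" by (metis coeff_0 zero_neq_one)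
    ultimately show ?thesis by blast
  next
    case True
    have "card (?w ` {..dimension}) > dimension" using card_image[OF True] by simp
    then have "dependent (?w ` {..dimension})"
      using dependent_biggerset_general dim_subset_UNIV
      by (metis finite_imageI finite_atMost le_less_trans)
    then obtain u where u: "(\<Sum>y\<in>?w ` {..dimension}. sm (u y) y) = 0"
        "\<exists>y\<in>?w ` {..dimension}. u y \<noteq> 0"
      by (auto simp: dependent_finite)
    then obtain k where k: "k \<le> dimension" "u (?w k) \<noteq> 0" by auto
    let ?p = "\<Sum>i\<le>dimension. smult (u (?w i)) (monom 1 i)"
    have "poly_act f v ?p = 0"
      using u(1) by (simp add: poly_act_sum[OF v(1)] sum.reindex[OF True] del: smult_monom)
    moreover have "coeff ?p k = u (?w k)"
      using k(1) by (simp add: coeff_sum if_distrib[of "\<lambda>x. _ * x"] cong: if_cong)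
    then have "?p \<noteq> 0" using k(2) by (metis coeff_0)
    ultimately show ?thesis by blast
  qed
  then obtain p where p: "p \<noteq> 0" "poly_act f v p = 0"
    and min: "\<And>q. q \<noteq> 0 \<and> poly_act f v q = 0 \<Longrightarrow> degree p \<le> degree q"
    using ex_has_least_nat[of "\<lambda>p. p \<noteq> 0 \<and> poly_act f v p = 0" _ degree] by blast
  have "degree p \<noteq> 0"
  proof
    assume "degree p = 0"
    then obtain a where "p = [:a:]" by (metis degree_eq_zeroE)
    with p v(2) show False by (simp add: poly_act_pCons f_0)
  qed
  with ac obtain z where "poly p z = 0" unfolding alg_closed_field_def by blast
  then obtain q where q: "p = [:-z, 1:] * q" by (metis dvdE poly_eq_0_iff_dvd)
  with p(1) have "q \<noteq> 0" by auto
  then have "degree p = Suc (degree q)" unfolding q by (subst degree_mult_eq) auto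
  with min[of q] \<open>q \<noteq> 0\<close> have nz: "poly_act f v q \<noteq> 0" by auto
  have "p = smult (-z) q + pCons 0 q" unfolding q by simp
  then have "sm (-z) (poly_act f v q) + f (poly_act f v q) = 0"
    using p(2) by (simp only: poly_act_add[OF v(1)] poly_act_smult[OF v(1)])
      (simp add: poly_act_pCons f_0)
  then have "f (poly_act f v q) = sm z (poly_act f v q)" by (simp add: add_eq_0_iff)
  with nz poly_act_closed[OF v(1)] show ?thesis by blast
qed

section \<open>Minimal left ideals, Schur's lemma and the density theorem\<close>

locale simple_algebra = fin_dim_algebra sm Basis
  for sm :: "'k::field \<Rightarrow> 'a::ring \<Rightarrow> 'a" and Basis +
  fixes R
  assumes alg_closed: "alg_closed_field TYPE('k)"
    and simple: "simple_alg sm R"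
begin

lemma subspace_R: "subspace R"
  using simple by (simp add: simple_alg_def subalg_def)

lemma mult_R: "x \<in> R \<Longrightarrow> y \<in> R \<Longrightarrow> x * y \<in> R"
  using simple by (simp add: simple_alg_def subalg_def)

lemma ideal_R: "ideal_in sm R I \<Longrightarrow> I = {0} \<or> I = R"
  using simple by (simp add: simple_alg_def)

definition left_ideal :: "'a set \<Rightarrow> bool" where
  "left_ideal L \<longleftrightarrow> subspace L \<and> L \<subseteq> R \<and> (\<forall>r\<in>R. \<forall>x\<in>L. r * x \<in> L)"

lemma minimal_left_ideal_exists:
  obtains L where "left_ideal L" "L \<noteq> {0}"
    "\<And>M. left_ideal M \<Longrightarrow> M \<subseteq> L \<Longrightarrow> M = {0} \<or> M = L"
proof -
  have "left_ideal R" "R \<noteq> {0}"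
    using simple mult_R unfolding left_ideal_def simple_alg_def subalg_def by auto
  then obtain L where L: "left_ideal L \<and> L \<noteq> {0}"
      "\<And>M. left_ideal M \<and> M \<noteq> {0} \<Longrightarrow> dim L \<le> dim M"
    using ex_has_least_nat[of "\<lambda>L. left_ideal L \<and> L \<noteq> {0}" R dim] by blast
  then show ?thesis
    using that[of L] subspace_dim_equal unfolding left_ideal_def by blast
qed

text \<open>Such elements form a two-sided ideal of \<open>R\<close>, which is proper because
  simplicity includes a nonzero product in \<open>R\<close>.\<close>

lemma right_annihilator_trivial:
  assumes "x \<in> R" "\<And>r. r \<in> R \<Longrightarrow> r * x = 0"
  shows "x = 0"
proof -
  let ?I = "{x \<in> R. \<forall>r\<in>R. r * x = 0}"
  have "ideal_in sm R ?I"
    unfolding ideal_in_def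
    using subspace_R by (auto intro!: subspaceI mult_R simp: subspace_0 subspace_add subspace_scale
        distrib_left scale_mult_right mult.assoc[symmetric])
  moreover have "?I \<noteq> R" using simple unfolding simple_alg_def by blast
  ultimately have "?I = {0}" using ideal_R by blast
  with assms show ?thesis by blast
qed

end

locale minimal_left_ideal = simple_algebra +
  fixes L
  assumes left_ideal: "left_ideal L" and L_nonzero: "L \<noteq> {0}"
    and minimal: "left_ideal M \<Longrightarrow> M \<subseteq> L \<Longrightarrow> M = {0} \<or> M = L"
begin

lemma subspace_L: "subspace L" and L_R: "x \<in> L \<Longrightarrow> x \<in> R"
  and mult_L: "r \<in> R \<Longrightarrow> x \<in> L \<Longrightarrow> r * x \<in> L"
  using left_ideal by (auto simp: left_ideal_def)

text \<open>The annihilator of \<open>L\<close> is a two-sided ideal of \<open>R\<close>. It is not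
  \<open>R\<close>, since \<open>R\<close> kills no nonzero element of \<open>L\<close>.\<close>

lemma faithful:
  assumes "r \<in> R" "\<And>x. x \<in> L \<Longrightarrow> r * x = 0"
  shows "r = 0"
proof -
  let ?I = "{r \<in> R. \<forall>x\<in>L. r * x = 0}"
  have "ideal_in sm R ?I"
    unfolding ideal_in_def
    using subspace_R by (auto intro!: subspaceI mult_R simp: subspace_0 subspace_add subspace_scale
        distrib_right scale_mult_left mult.assoc mult_L)
  moreover have "?I \<noteq> R"
    using right_annihilator_trivial L_R L_nonzero subspace_0[OF subspace_L] by blast
  ultimately have "?I = {0}" using ideal_R by blast
  with assms show ?thesis by blast
qed

lemma left_ideal_image:
  assumes "left_ideal M" "x \<in> L"
  shows "left_ideal ((\<lambda>r. r * x) ` M)"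
proof -
  have "subspace ((\<lambda>r. r * x) ` M)"
  proof (rule subspaceI)
    show "0 \<in> (\<lambda>r. r * x) ` M"
      using assms subspace_0 by (force simp: left_ideal_def)
    fix a b assume "a \<in> (\<lambda>r. r * x) ` M" "b \<in> (\<lambda>r. r * x) ` M"
    then obtain r s where rs: "r \<in> M" "a = r * x" "s \<in> M" "b = s * x" by blast
    then show "a + b \<in> (\<lambda>r. r * x) ` M"
      using assms by (intro image_eqI[of _ _ "r + s"]) (auto simp: distrib_right left_ideal_def subspace_add)
    show "sm c a \<in> (\<lambda>r. r * x) ` M" for c
      using assms rs by (intro image_eqI[of _ _ "sm c r"])
        (auto simp: scale_mult_left left_ideal_def subspace_scale)
  qed
  moreover have "(\<lambda>r. r * x) ` M \<subseteq> R"
    using assms L_R mult_R unfolding left_ideal_def by blast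
  moreover have "s * y \<in> (\<lambda>r. r * x) ` M" if s: "s \<in> R" and y: "y \<in> (\<lambda>r. r * x) ` M" for s y
  proof -
    from y obtain r where "r \<in> M" "y = r * x" by blast
    with assms(1) s show ?thesis
      by (intro image_eqI[of _ _ "s * r"]) (simp_all add: left_ideal_def mult.assoc)
  qed
  ultimately show ?thesis unfolding left_ideal_def by blast
qed

text \<open>The image is a nonzero left ideal inside the minimal one. Below, \<open>M\<close> is the
  annihilator of a finite set.\<close>

lemma transitive:
  assumes "left_ideal M" "x \<in> L" "r \<in> M" "r * x \<noteq> 0"
  shows "(\<lambda>r. r * x) ` M = L"
proof -
  have "(\<lambda>r. r * x) ` M \<subseteq> L" using assms mult_L unfolding left_ideal_def by blast
  then show ?thesis
    using minimal[OF left_ideal_image[OF assms(1,2)]] assms(3,4) by blast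
qed

text \<open>An eigenspace of a map commuting with \<open>R\<close> is a left ideal, so by minimality
  it is all of \<open>L\<close>.\<close>

lemma schur:
  assumes "endomorphism_on sm L f"
    and comm: "\<And>r x. r \<in> R \<Longrightarrow> x \<in> L \<Longrightarrow> f (r * x) = r * f x"
  shows "\<exists>z. \<forall>x\<in>L. f x = sm z x"
proof -
  interpret endomorphism_on sm L f by fact
  obtain v where "v \<in> L" "v \<noteq> 0" using L_nonzero subspace_0[OF subspace_L] by blast
  then obtain z x where zx: "x \<in> L" "x \<noteq> 0" "f x = sm z x"
    using eigenvector_exists[OF alg_closed assms(1)] by blast
  let ?M = "{x \<in> L. f x = sm z x}"
  have "left_ideal ?M"
    unfolding left_ideal_def using subspace_L
    by (auto intro!: subspaceI simp: subspace_0 subspace_add subspace_scale L_R mult_L comm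
        f_0 f_add f_scale scale_right_distrib scale_mult_right mult.commute)
  then have "?M = L" using minimal[of ?M] zx by blast
  then show ?thesis by blast
qed

lemma left_ideal_annihilator: "left_ideal {r \<in> R. \<forall>x\<in>X. r * x = 0}"
  unfolding left_ideal_def using subspace_R
  by (auto intro!: subspaceI simp: subspace_0 subspace_add subspace_scale mult_R
      distrib_right scale_mult_left mult.assoc)

text \<open>Suppose that the annihilator \<open>?A\<close> of \<open>X\<close> kills
  \<open>v\<close> as soon as it kills \<open>u\<close>. Then \<open>r * u\<close> \<mapsto>
  \<open>r * v\<close> is a well-defined map on \<open>L\<close> commuting with \<open>R\<close>,
  hence a scalar \<open>z\<close>. So \<open>?A\<close> kills \<open>v - sm z u\<close>, which by
  induction lies in the span of \<open>X\<close>, against the choice of \<open>v\<close>.\<close>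

lemma density_step:
  assumes "finite X"
  shows "X \<subseteq> L \<Longrightarrow> v \<in> L \<Longrightarrow> v \<notin> span X \<Longrightarrow> \<exists>r\<in>R. (\<forall>x\<in>X. r * x = 0) \<and> r * v \<noteq> 0"
  using assms
proof (induction X arbitrary: v rule: finite_induct)
  case empty
  then show ?case using right_annihilator_trivial[of v] L_R by auto
next
  case (insert u X)
  let ?A = "{r \<in> R. \<forall>x\<in>X. r * x = 0}"
  have A: "left_ideal ?A" by (rule left_ideal_annihilator)
  then have sub: "subspace ?A" by (simp add: left_ideal_def)
  have uL: "u \<in> L" using insert.prems by simp
  show ?case
  proof (rule ccontr)
    assume contra: "\<not> ?case"
    have kill: "r * v = 0" if "r \<in> ?A" "r * u = 0" for r using that contra by auto
    \<comment> \<open>Otherwise the induction hypothesis for \<open>v\<close> itself gives an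
      \<open>r\<close> in \<open>?A\<close> not killing \<open>v\<close>, and this \<open>r\<close>
      kills \<open>u\<close> along with \<open>X\<close>.\<close>
    have "u \<notin> span X"
    proof
      assume "u \<in> span X"
      then have "span (insert u X) = span X" by (rule span_redundant)
      then obtain r where "r \<in> ?A" "r * v \<noteq> 0"
        using insert.IH[of v] insert.prems by auto
      moreover have "r * u = 0"
        using \<open>u \<in> span X\<close>
        by (induction rule: span_induct)
          (use \<open>r \<in> ?A\<close> in \<open>auto intro!: subspaceI simp: distrib_left scale_mult_right\<close>)
      ultimately show False using kill by blast
    qed
    then obtain r0 where "r0 \<in> ?A" "r0 * u \<noteq> 0" using insert.IH[of u] insert.prems by auto
    then have surj: "(\<lambda>r. r * u) ` ?A = L" by (intro transitive[OF A uL])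
    define g where "g y = (SOME r. r \<in> ?A \<and> r * u = y)" for y
    have g: "g y \<in> ?A" "g y * u = y" if "y \<in> L" for y
    proof -
      have "\<exists>r. r \<in> ?A \<and> r * u = y" using surj that by blast
      from someI_ex[OF this] show "g y \<in> ?A" "g y * u = y" by (auto simp: g_def)
    qed
    define f where "f y = g y * v" for y
    \<comment> \<open>The representative picked by \<open>g\<close> does not matter: two of them
      differ by an element of \<open>?A\<close> killing \<open>u\<close>, hence
      \<open>v\<close>.\<close>
    have f: "f (r * u) = r * v" if "r \<in> ?A" for r
    proof -
      have "r * u \<in> L" using surj that by blast
      note g' = g[OF this]
      have "g (r * u) - r \<in> ?A"
        using sub g'(1) that by (rule subspace_diff)
      then have "(g (r * u) - r) * v = 0"
        by (rule kill) (simp add: left_diff_distrib g'(2))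
      then show ?thesis by (simp add: f_def left_diff_distrib)
    qed
    have f_eq: "f y = r * v" if "r \<in> ?A" "y = r * u" for r y using f that by simp
    have comm: "f (s * y) = s * f y" if "s \<in> R" "y \<in> L" for s y
    proof -
      from that obtain r where r: "r \<in> ?A" "y = r * u" using surj by blast
      moreover have "s * r \<in> ?A" using A r that unfolding left_ideal_def by blast
      ultimately show ?thesis
        using f_eq[OF r] f_eq[of "s * r" "s * y"] by (simp add: mult.assoc)
    qed
    have "endomorphism_on sm L f"
    proof unfold_locales
      fix x y c assume x: "x \<in> L"
      then obtain r where r: "r \<in> ?A" "x = r * u" using surj by blast
      then show "f x \<in> L" using mult_L[of r v] insert.prems f_eq[OF r] by simp
      have "sm c r \<in> ?A" using sub r(1) by (rule subspace_scale)
      then show "f (sm c x) = sm c (f x)"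
        using r f_eq[OF r] f_eq[of "sm c r" "sm c x"] by (simp add: scale_mult_left)
      assume y: "y \<in> L"
      then obtain s where s: "s \<in> ?A" "y = s * u" using surj by blast
      have "r + s \<in> ?A" using sub r(1) s(1) by (rule subspace_add)
      then show "f (x + y) = f x + f y"
        using r s f_eq[OF r] f_eq[OF s] f_eq[of "r + s" "x + y"] by (simp add: distrib_right)
    qed (rule subspace_L)
    from schur[OF this comm] obtain z where z: "\<And>x. x \<in> L \<Longrightarrow> f x = sm z x" by blast
    have "v - sm z u \<notin> span X"
      using insert.prems by (auto simp: span_insert)
    moreover have "v - sm z u \<in> L"
      using insert.prems subspace_L by (auto intro: subspace_diff subspace_scale)
    ultimately obtain r where r: "r \<in> ?A" "r * (v - sm z u) \<noteq> 0"
      using insert.IH[of "v - sm z u"] insert.prems by auto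
    have "r * u \<in> L" using surj r by blast
    then have "r * v = sm z (r * u)" using f[OF r(1)] z by simp
    with r(2) show False by (simp add: right_diff_distrib scale_mult_right)
  qed
qed

text \<open>The annihilator of the other vectors does not kill \<open>u\<close>, so by transitivity
  it carries \<open>u\<close> to every element of \<open>L\<close>.\<close>

lemma density:
  assumes "finite X" "X \<subseteq> L" "independent X" "u \<in> X" "y \<in> L"
  shows "\<exists>r\<in>R. r * u = y \<and> (\<forall>x\<in>X - {u}. r * x = 0)"
proof -
  let ?A = "{r \<in> R. \<forall>x\<in>X - {u}. r * x = 0}"
  have A: "left_ideal ?A" by (rule left_ideal_annihilator)
  have "u \<notin> span (X - {u})" using assms by (auto simp: dependent_def)
  then obtain r where "r \<in> ?A" "r * u \<noteq> 0"
    using density_step[of "X - {u}" u] assms by auto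
  then have "(\<lambda>r. r * u) ` ?A = L" using transitive[OF A, of u r] assms by blast
  then obtain r where "r \<in> ?A" "y = r * u" using assms(5) by blast
  then show ?thesis by auto
qed

text \<open>Fix a basis of \<open>L\<close>. By density some \<open>e p r\<close> sends the
  \<open>r\<close>-th basis vector to the \<open>p\<close>-th and kills the others. By faithfulness
  an element of \<open>R\<close> is determined by its action on the basis, which yields both the
  multiplication table and the spanning property.\<close>

lemma matrix_units_exist:
  "\<exists>n e. 0 < (n::nat) \<and> (\<forall>p<n. \<forall>r<n. e p r \<noteq> 0) \<and>
     (\<forall>p<n. \<forall>r<n. \<forall>p'<n. \<forall>r'<n. e p r * e p' r' = (if r = p' then e p r' else 0)) \<and>
     R = span {e p r |p r. p < n \<and> r < n}"
proof -
  obtain X where X: "X \<subseteq> L" "independent X" "L \<subseteq> span X" "card X = dim L"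
    using basis_exists[of L] by blast
  have "finite X" using X(2) by (rule finiteI_independent)
  then obtain xs where xs: "set xs = X" "distinct xs" using finite_distinct_list by blast
  define n where "n = length xs"
  have ex: "\<exists>t\<in>R. t * xs ! r = xs ! p \<and> (\<forall>s<n. s \<noteq> r \<longrightarrow> t * xs ! s = 0)"
    if "p < n" "r < n" for p r
  proof -
    have "xs ! r \<in> X" "xs ! p \<in> L" using that xs X(1) by (auto simp: n_def)
    from density[OF \<open>finite X\<close> X(1,2) this] obtain t where
      "t \<in> R" "t * xs ! r = xs ! p" "\<forall>x\<in>X - {xs ! r}. t * x = 0" by blast
    then show ?thesis
      using xs that by (intro bexI[of _ t]) (auto simp: n_def nth_eq_iff_index_eq)
  qed
  then obtain e where e: "\<And>p r. p < n \<Longrightarrow> r < n \<Longrightarrow> e p r \<in> R"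
      "\<And>p r s. p < n \<Longrightarrow> r < n \<Longrightarrow> s < n \<Longrightarrow> e p r * xs ! s = (if s = r then xs ! p else 0)"
    by metis
  have eqI: "t = t'" if t: "t \<in> R" "t' \<in> R" "\<And>s. s < n \<Longrightarrow> t * xs ! s = t' * xs ! s" for t t'
  proof -
    have "(t - t') * x = 0" if "x \<in> L" for x
    proof -
      have sub: "subspace {x. (t - t') * x = 0}"
        by (auto intro!: subspaceI simp: distrib_left scale_mult_right)
      have "(t - t') * x = 0" if "x \<in> X" for x
      proof -
        from that xs obtain s where "s < n" "x = xs ! s" by (auto simp: in_set_conv_nth n_def)
        with t(3) show ?thesis by (simp add: left_diff_distrib)
      qed
      then have "span X \<subseteq> {x. (t - t') * x = 0}" by (intro span_minimal sub) blast
      then show ?thesis using that X(3) by blast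
    qed
    then have "t - t' = 0"
      using faithful[OF subspace_diff[OF subspace_R t(1,2)]] by blast
    then show ?thesis by simp
  qed
  have xs_nz: "xs ! p \<noteq> 0" if "p < n" for p
    using that X(2) xs dependent_zero by (metis n_def nth_mem)
  have pos: "0 < n"
  proof (rule ccontr)
    assume "\<not> 0 < n"
    then have "L \<subseteq> {0}" using X(3) xs by (simp add: n_def)
    then show False using L_nonzero subspace_0[OF subspace_L] by blast
  qed
  have nz: "e p r \<noteq> 0" if "p < n" "r < n" for p r
    using e(2)[OF that that(2)] xs_nz[OF that(1)] by auto
  have mult: "e p r * e p' r' = (if r = p' then e p r' else 0)"
    if "p < n" "r < n" "p' < n" "r' < n" for p r p' r'
  proof (rule eqI)
    show "e p r * e p' r' \<in> R" "(if r = p' then e p r' else 0) \<in> R"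
      using that e(1) subspace_0[OF subspace_R] by (auto intro: mult_R)
    show "e p r * e p' r' * xs ! s = (if r = p' then e p r' else 0) * xs ! s" if "s < n" for s
      using that \<open>p < n\<close> \<open>r < n\<close> \<open>p' < n\<close> \<open>r' < n\<close> by (simp add: mult.assoc e(2))
  qed
  have gen: "R = span {e p r |p r. p < n \<and> r < n}" (is "_ = span ?E")
  proof
    show "span ?E \<subseteq> R" using e(1) by (intro span_minimal subspace_R) auto
    show "R \<subseteq> span ?E"
    proof
      fix t assume t: "t \<in> R"
      have "\<exists>c. t * xs ! s = (\<Sum>p<n. sm (c p) (xs ! p))" if "s < n" for s
      proof -
        have "t * xs ! s \<in> L" using that t xs X(1) by (auto intro!: mult_L simp: n_def)
        then have "t * xs ! s \<in> span X" using X(3) by blast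
        then obtain c where "t * xs ! s = (\<Sum>x\<in>X. sm (c x) x)"
          using span_finite[OF \<open>finite X\<close>] by auto
        also have "\<dots> = (\<Sum>p<n. sm (c (xs ! p)) (xs ! p))"
          using xs by (intro sum.reindex_bij_betw[symmetric, of "(!) xs"])
            (auto simp: n_def intro: bij_betw_nth)
        finally show ?thesis by (intro exI[of _ "\<lambda>p. c (xs ! p)"])
      qed
      then obtain c where c: "\<And>s. s < n \<Longrightarrow> t * xs ! s = (\<Sum>p<n. sm (c s p) (xs ! p))" by metis
      have "t = (\<Sum>r<n. \<Sum>p<n. sm (c r p) (e p r))"
      proof (rule eqI)
        show "(\<Sum>r<n. \<Sum>p<n. sm (c r p) (e p r)) \<in> R"
          using e(1) by (intro subspace_sum subspace_scale subspace_R) auto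
        fix s assume s: "s < n"
        have "(\<Sum>r<n. \<Sum>p<n. sm (c r p) (e p r)) * xs ! s
            = (\<Sum>r<n. \<Sum>p<n. sm (c r p) (if s = r then xs ! p else 0))"
          unfolding sum_distrib_right scale_mult_left
          using s by (intro sum.cong refl) (simp add: e(2))
        also have "\<dots> = (\<Sum>r<n. if s = r then (\<Sum>p<n. sm (c r p) (xs ! p)) else 0)"
          by (intro sum.cong refl) simp
        also have "\<dots> = t * xs ! s" using s c by simp
        finally show "t * xs ! s = (\<Sum>r<n. \<Sum>p<n. sm (c r p) (e p r)) * xs ! s" by simp
      qed (rule t)
      also have "\<dots> \<in> span ?E"
        by (intro span_sum span_scale span_base) auto
      finally show "t \<in> span ?E" .
    qed
  qed
  show ?thesis
    by (intro exI[of _ n] exI[of _ e] conjI allI impI; (rule pos nz mult gen; assumption?))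
qed

end

lemma (in fin_dim_algebra) simple_alg_matrix_units:
  assumes "alg_closed_field TYPE('k)" "simple_alg sm R"
  shows "\<exists>n e. 0 < (n::nat) \<and> (\<forall>p<n. \<forall>r<n. e p r \<noteq> 0) \<and>
     (\<forall>p<n. \<forall>r<n. \<forall>p'<n. \<forall>r'<n. e p r * e p' r' = (if r = p' then e p r' else 0)) \<and>
     R = span {e p r |p r. p < n \<and> r < n}"
proof -
  interpret simple_algebra sm Basis R by unfold_locales (fact assms)+
  obtain L where L: "left_ideal L" "L \<noteq> {0}"
      "\<And>M. left_ideal M \<Longrightarrow> M \<subseteq> L \<Longrightarrow> M = {0} \<or> M = L"
    using minimal_left_ideal_exists by blast
  interpret minimal_left_ideal sm Basis R L by unfold_locales (fact L)+
  show ?thesis by (rule matrix_units_exist)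
qed

section \<open>Alternating polynomials\<close>

text \<open>The arguments are replaced one at a time: if \<open>g\<close> vanished at every element
  of \<open>E v\<close> in coordinate \<open>v\<close>, it would vanish on the whole span. The set
  \<open>E v\<close> may vary with \<open>v\<close>, as needed when each factor comes from its own
  simple component.\<close>

lemma multilinear_nonzero_on_spanning:
  assumes "vector_space sm" "finite V"
    and add: "\<And>v x a b. v \<in> V \<Longrightarrow> g (x(v := a + b)) = g (x(v := a)) + (g (x(v := b)) :: 'a::ab_group_add)"
    and scale: "\<And>v x a c. v \<in> V \<Longrightarrow> g (x(v := sm c a)) = sm c (g (x(v := a)))"
    and "g x \<noteq> 0" "\<And>v. v \<in> V \<Longrightarrow> x v \<in> module.span sm (E v)"
  shows "\<exists>y. (\<forall>v\<in>V. y v \<in> E v) \<and> (\<forall>v. v \<notin> V \<longrightarrow> y v = x v) \<and> g y \<noteq> 0"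
  using assms(2-)
proof (induction V rule: finite_induct)
  case empty
  then show ?case by auto
next
  case (insert v V)
  interpret vector_space sm by fact
  have "\<exists>y. (\<forall>v\<in>V. y v \<in> E v) \<and> (\<forall>v. v \<notin> V \<longrightarrow> y v = x v) \<and> g y \<noteq> 0"
    using insert.prems by (intro insert.IH) auto
  then obtain y where y: "\<forall>v\<in>V. y v \<in> E v" "\<forall>v. v \<notin> V \<longrightarrow> y v = x v" "g y \<noteq> 0" by blast
  have "\<exists>b\<in>E v. g (y(v := b)) \<noteq> 0"
  proof (rule ccontr)
    assume *: "\<not> ?thesis"
    have "g (y(v := 0)) = 0"
      using insert.prems(2)[OF insertI1, of y 0 0] by (simp only: scale_zero_left)
    then have "subspace {a. g (y(v := a)) = 0}"
      using insert.prems(1,2)[OF insertI1] by (auto intro!: subspaceI simp del: fun_upd_apply)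
    then have "span (E v) \<subseteq> {a. g (y(v := a)) = 0}"
      using * by (intro span_minimal) auto
    moreover have "y v \<in> span (E v)" using insert y by auto
    ultimately have "g (y(v := y v)) = 0" by blast
    with y(3) show False by simp
  qed
  then obtain b where "b \<in> E v" "g (y(v := b)) \<noteq> 0" by blast
  moreover have "\<forall>u\<in>insert v V. (y(v := b)) u \<in> E u" using y(1) \<open>b \<in> E v\<close> by auto
  moreover have "\<forall>u. u \<notin> insert v V \<longrightarrow> (y(v := b)) u = x u" using y(2) by auto
  ultimately show ?case by blast
qed

section \<open>Alternation of a monomial over a set of permutations\<close>

definition altsum :: "('k::field \<Rightarrow> 'a::ring \<Rightarrow> 'a) \<Rightarrow> ('v \<Rightarrow> 'v) set \<Rightarrow> 'v list \<Rightarrow> ('v \<Rightarrow> 'a) \<Rightarrow> 'a" where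
  "altsum sm G L y = (\<Sum>\<pi>\<in>G. sm (of_int (sign \<pi>)) (prodl (map (y \<circ> \<pi>) L)))"

text \<open>The variables are coded by \<open>to_nat\<close> because identities are coefficient
  functions on words over \<open>nat\<close>. Permutations producing the same word have their signs
  added.\<close>

definition altpoly :: "('v::countable \<Rightarrow> 'v) set \<Rightarrow> 'v list \<Rightarrow> nat list \<Rightarrow> 'k::field" where
  "altpoly G L w = (\<Sum>\<pi> | \<pi> \<in> G \<and> map (to_nat \<circ> \<pi>) L = w. of_int (sign \<pi>))"

lemma altpoly_support:
  "{w. altpoly G L w \<noteq> (0::'k::field)} \<subseteq> (\<lambda>\<pi>. map (to_nat \<circ> \<pi>) L) ` G"
proof
  fix w assume "w \<in> {w. altpoly G L w \<noteq> (0::'k)}"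
  then have "{\<pi> \<in> G. map (to_nat \<circ> \<pi>) L = w} \<noteq> {}" unfolding altpoly_def by force
  then show "w \<in> (\<lambda>\<pi>. map (to_nat \<circ> \<pi>) L) ` G" by blast
qed

text \<open>Sorting the permutations by the word they produce turns the sum over words into a sum
  over \<open>G\<close>; words whose signs cancel contribute zero.\<close>

lemma peval_altpoly:
  assumes "vector_space sm" "finite G"
  shows "peval sm (altpoly G L) x = altsum sm G L (x \<circ> to_nat)"
proof -
  interpret vector_space sm by fact
  let ?w = "\<lambda>\<pi>. map (to_nat \<circ> \<pi>) L"
  have "peval sm (altpoly G L) x = (\<Sum>w\<in>?w ` G. sm (altpoly G L w) (prodw x w))"
    unfolding peval_def using assms(2) altpoly_support[of G L]
    by (intro sum.mono_neutral_left) auto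
  also have "\<dots> = (\<Sum>w\<in>?w ` G. \<Sum>\<pi> | \<pi> \<in> G \<and> ?w \<pi> = w.
      sm (of_int (sign \<pi>)) (prodl (map (x \<circ> to_nat \<circ> \<pi>) L)))"
  proof (intro sum.cong refl)
    fix w
    have "prodw x w = prodl (map (x \<circ> to_nat \<circ> \<pi>) L)" if "?w \<pi> = w" for \<pi>
      using that by (auto simp: prodw_eq_prodl comp_assoc)
    then show "sm (altpoly G L w) (prodw x w) = (\<Sum>\<pi> | \<pi> \<in> G \<and> ?w \<pi> = w.
        sm (of_int (sign \<pi>)) (prodl (map (x \<circ> to_nat \<circ> \<pi>) L)))"
      unfolding altpoly_def scale_sum_left 
      by (intro sum.cong refl arg_cong2[of _ _ _ _ sm]) blast
  qed
  also have "\<dots> = altsum sm G L (x \<circ> to_nat)"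
    unfolding altsum_def by (rule sum.image_gen[OF assms(2), symmetric])
  finally show ?thesis .
qed

text \<open>This is where identities enter: if every value on \<open>sb\<close> vanished,
  \<open>altpoly G L\<close> would be an identity of \<open>sb\<close>, hence of \<open>sa\<close>.
  A nonempty \<open>L\<close> secures the zero constant term required in
  \<open>PI_Id\<close>.\<close>

lemma altsum_transfer:
  fixes sa :: "'k::field \<Rightarrow> 'a::ring \<Rightarrow> 'a" and sb :: "'k \<Rightarrow> 'b::ring \<Rightarrow> 'b"
    and L :: "'v::countable list"
  assumes "vector_space sa" "vector_space sb" "PI_Id sb \<subseteq> PI_Id sa" "finite G" "L \<noteq> []"
    and nz: "altsum sa G L y \<noteq> 0"
  shows "\<exists>y'. altsum sb G L y' \<noteq> 0"
proof (rule ccontr)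
  assume *: "\<not> ?thesis"
  let ?f = "altpoly G L :: nat list \<Rightarrow> 'k"
  have "finite {w. ?f w \<noteq> 0}" using altpoly_support assms(4) by (metis finite_imageI finite_subset)
  moreover have "?f [] = 0" using assms(5) by (simp add: altpoly_def)
  ultimately have "?f \<in> PI_Id sb"
    using * peval_altpoly[OF assms(2,4)] by (auto simp: PI_Id_def)
  then have "?f \<in> PI_Id sa" using assms(3) by blast
  then have "peval sa ?f (y \<circ> from_nat) = 0" by (simp add: PI_Id_def)
  moreover have "y \<circ> from_nat \<circ> to_nat = y" by (auto simp: fun_eq_iff)
  ultimately show False using nz peval_altpoly[OF assms(1,4)] by metis
qed

text \<open>The product of the symmetric groups on the fibres of \<open>b\<close> in
  \<open>X\<close>.\<close>

definition block_perms :: "'v set \<Rightarrow> ('v \<Rightarrow> 'c) \<Rightarrow> ('v \<Rightarrow> 'v) set" where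
  "block_perms X b = {\<pi>. \<pi> permutes X \<and> (\<forall>v. b (\<pi> v) = b v)}"

lemma finite_block_perms: "finite X \<Longrightarrow> finite (block_perms X b)"
  unfolding block_perms_def by (rule finite_subset[OF _ finite_permutations[of X]]) auto

text \<open>Composition with the transposition of \<open>u\<close> and \<open>v\<close> maps the
  group to itself, reverses signs and leaves the values alone. The sum equals its own negative, so
  it is zero in characteristic zero.\<close>

lemma altsum_collision:
  fixes sm :: "'k::field_char_0 \<Rightarrow> 'a::ring \<Rightarrow> 'a"
  assumes "vector_space sm" "finite X" "u \<in> X" "v \<in> X" "u \<noteq> v" "b u = b v" "y u = y v"
  shows "altsum sm (block_perms X b) L y = 0"
proof -
  interpret vector_space sm by fact
  let ?G = "block_perms X b" and ?t = "transpose u v"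
  have bt: "b (?t w) = b w" and yt: "y (?t w) = y w" for w
    using assms by (auto simp: transpose_def)
  have tX: "?t permutes X" using assms by (intro permutes_swap_id)
  have closed: "?t \<circ> \<pi> \<in> ?G" if "\<pi> \<in> ?G" for \<pi>
    using that tX bt by (auto simp: block_perms_def intro: permutes_compose)
  have "bij_betw (\<lambda>\<pi>. ?t \<circ> \<pi>) ?G ?G"
    by (rule bij_betw_byWitness[of _ "\<lambda>\<pi>. ?t \<circ> \<pi>"])
      (use closed in \<open>auto simp: comp_assoc[symmetric]\<close>)
  then have "altsum sm ?G L y =
      (\<Sum>\<pi>\<in>?G. sm (of_int (sign (?t \<circ> \<pi>))) (prodl (map (y \<circ> (?t \<circ> \<pi>)) L)))"
    unfolding altsum_def by (rule sum.reindex_bij_betw[symmetric])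
  also have "\<dots> = (\<Sum>\<pi>\<in>?G. - sm (of_int (sign \<pi>)) (prodl (map (y \<circ> \<pi>) L)))"
  proof (intro sum.cong refl)
    fix \<pi> assume "\<pi> \<in> ?G"
    then have "permutation \<pi>" using assms(2) by (auto simp: block_perms_def permutation_permutes)
    then have "sign (?t \<circ> \<pi>) = - sign \<pi>"
      using assms(5) by (simp add: sign_compose permutation_swap_id sign_swap_id)
    moreover have "y \<circ> (?t \<circ> \<pi>) = y \<circ> \<pi>" using yt by (auto simp: fun_eq_iff)
    ultimately show "sm (of_int (sign (?t \<circ> \<pi>))) (prodl (map (y \<circ> (?t \<circ> \<pi>)) L)) =
        - sm (of_int (sign \<pi>)) (prodl (map (y \<circ> \<pi>) L))" by simp
  qed
  also have "\<dots> = - altsum sm ?G L y" by (simp add: altsum_def sum_negf)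
  finally have "altsum sm ?G L y + altsum sm ?G L y = 0" by (metis add.right_inverse)
  then have "sm 2 (altsum sm ?G L y) = 0"
    using scale_left_distrib[of 1 1 "altsum sm ?G L y"] by simp
  then show ?thesis by simp
qed

section \<open>Multilinearity of alternating sums\<close>

context algebra
begin

lemma prodl_add_coord:
  "distinct w \<Longrightarrow> v \<in> set w \<Longrightarrow>
   prodl (map (y(v := a + b)) w) = prodl (map (y(v := a)) w) + prodl (map (y(v := b)) w)"
proof (induction w)
  case (Cons u w)
  consider "w = []" | "w \<noteq> []" "u = v" | "w \<noteq> []" "u \<noteq> v" by blast
  then show ?case
  proof cases
    case 2
    then have "map (y(v := c)) (u # w) = c # map y w" for c using Cons.prems by auto
    with 2 have "prodl (map (y(v := c)) (u # w)) = c * prodl (map y w)" for c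
      by (metis prodl_Cons map_is_Nil_conv)
    then show ?thesis by (simp only: distrib_right)
  next
    case 3
    then have "prodl (map (y(v := c)) (u # w)) = y u * prodl (map (y(v := c)) w)" for c
      by (simp add: prodl_Cons)
    moreover have "distinct w" "v \<in> set w" using Cons.prems 3 by auto
    note Cons.IH[OF this]
    ultimately show ?thesis by (simp only: distrib_left)
  qed (use Cons in auto)
qed simp

lemma prodl_scale_coord:
  "distinct w \<Longrightarrow> v \<in> set w \<Longrightarrow>
   prodl (map (y(v := sm c a)) w) = sm c (prodl (map (y(v := a)) w))"
proof (induction w)
  case (Cons u w)
  consider "w = []" | "w \<noteq> []" "u = v" | "w \<noteq> []" "u \<noteq> v" by blast
  then show ?case
  proof cases
    case 2
    then have "map (y(v := c)) (u # w) = c # map y w" for c using Cons.prems by auto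
    with 2 have "prodl (map (y(v := c)) (u # w)) = c * prodl (map y w)" for c
      by (metis prodl_Cons map_is_Nil_conv)
    then show ?thesis by (simp only: scale_mult_left)
  next
    case 3
    then have "prodl (map (y(v := c)) (u # w)) = y u * prodl (map (y(v := c)) w)" for c
      by (simp add: prodl_Cons)
    moreover have "distinct w" "v \<in> set w" using Cons.prems 3 by auto
    note Cons.IH[OF this]
    ultimately show ?thesis by (simp only: scale_mult_right)
  qed (use Cons in auto)
qed simp

text \<open>Each permutation only rearranges the variables of \<open>L\<close>, so every one of them
  occurs exactly once in each summand and the alternating sum is multilinear.\<close>

lemma altsum_nonzero_on_spanning:
  assumes "distinct L" "X \<subseteq> set L" "altsum sm (block_perms X b) L x \<noteq> 0" "span E = UNIV"
  shows "\<exists>y. (\<forall>v\<in>set L. y v \<in> E) \<and> altsum sm (block_perms X b) L y \<noteq> 0"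
proof -
  let ?G = "block_perms X b"
  have perm: "distinct (map \<pi> L)" "set (map \<pi> L) = set L" if "\<pi> \<in> ?G" for \<pi>
  proof -
    have "\<pi> permutes set L" using that assms(2) by (auto simp: block_perms_def intro: permutes_subset)
    then show "distinct (map \<pi> L)" "set (map \<pi> L) = set L"
      using assms(1) by (auto simp: distinct_map permutes_inj_on permutes_image)
  qed
  have "\<exists>y. (\<forall>v\<in>set L. y v \<in> E) \<and> (\<forall>v. v \<notin> set L \<longrightarrow> y v = x v) \<and> altsum sm ?G L y \<noteq> 0"
  proof (rule multilinear_nonzero_on_spanning)
    show "vector_space sm" ..
    fix v x a b c assume v: "v \<in> set L"
    show "altsum sm ?G L (x(v := a + b)) = altsum sm ?G L (x(v := a)) + altsum sm ?G L (x(v := b))"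
      unfolding altsum_def sum.distrib[symmetric] map_map[symmetric]
      using perm v by (intro sum.cong refl) (simp add: prodl_add_coord scale_right_distrib del: map_map)
    show "altsum sm ?G L (x(v := sm c a)) = sm c (altsum sm ?G L (x(v := a)))"
      unfolding altsum_def scale_sum_right map_map[symmetric]
      using perm v by (intro sum.cong refl) (simp add: prodl_scale_coord mult.commute del: map_map)
  qed (use assms in auto)
  then show ?thesis by blast
qed

end

section \<open>The test word\<close>

text \<open>The variables \<open>Lft k i p r\<close> and \<open>Rgt k i p r\<close> are never permuted. Evaluated at matrix units
  they pin down the value of the variable \<open>Mid k i p r\<close> between them, so that of all terms of the
  alternating sum only the one of the identity permutation survives.\<close>

datatype var = Lft nat nat nat nat | Mid nat nat nat nat | Rgt nat nat nat nat | Lnk nat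

instance var :: countable
  by countable_datatype

text \<open>\<open>Lft\<close> and \<open>Rgt\<close> belong to a block although only
  \<open>Mid\<close> variables are permuted: a radical value at any of the three must disqualify the
  block.\<close>

primrec blk :: "var \<Rightarrow> nat option" where
  "blk (Lft k i p r) = Some k"
| "blk (Mid k i p r) = Some k"
| "blk (Rgt k i p r) = Some k"
| "blk (Lnk i) = None"

definition seg :: "(nat \<Rightarrow> nat) \<Rightarrow> nat \<Rightarrow> nat \<Rightarrow> var list" where
  "seg n i k = concat (map (\<lambda>(p, r). [Lft k i p r, Mid k i p r, Rgt k i p r])
     (List.product [0..<n i] [0..<n i]))"

text \<open>A link also closes the last group; it will receive the final factor of the chain that
  witnesses fullness.\<close>

definition word :: "nat \<Rightarrow> (nat \<Rightarrow> nat) \<Rightarrow> nat \<Rightarrow> var list" where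
  "word q n N = concat (map (\<lambda>i. concat (map (seg n i) [0..<N]) @ [Lnk i]) [0..<q])"

definition mids :: "nat \<Rightarrow> (nat \<Rightarrow> nat) \<Rightarrow> nat \<Rightarrow> var set" where
  "mids q n N = {Mid k i p r |k i p r. k < N \<and> i < q \<and> p < n i \<and> r < n i}"

abbreviation word_perms :: "nat \<Rightarrow> (nat \<Rightarrow> nat) \<Rightarrow> nat \<Rightarrow> (var \<Rightarrow> var) set" where
  "word_perms q n N \<equiv> block_perms (mids q n N) blk"

lemma set_seg:
  "set (seg n i k) = {v. \<exists>p<n i. \<exists>r<n i. v = Lft k i p r \<or> v = Mid k i p r \<or> v = Rgt k i p r}"
  by (auto simp: seg_def)

lemma set_word: "set (word q n N) = (\<Union>i<q. insert (Lnk i) (\<Union>k<N. set (seg n i k)))"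
  by (auto simp: word_def)

lemma distinct_concat_map:
  assumes "distinct xs" "\<And>x. x \<in> set xs \<Longrightarrow> distinct (f x)"
    "\<And>x y. x \<in> set xs \<Longrightarrow> y \<in> set xs \<Longrightarrow> x \<noteq> y \<Longrightarrow> set (f x) \<inter> set (f y) = {}"
  shows "distinct (concat (map f xs))"
  using assms by (induction xs) auto

lemma distinct_seg: "distinct (seg n i k)"
  unfolding seg_def by (intro distinct_concat_map) (auto intro: distinct_product)

lemma distinct_word: "distinct (word q n N)"
  unfolding word_def
  by (intro distinct_concat_map)
    (auto simp: distinct_seg set_seg intro!: distinct_concat_map)

lemma mids_subset_word: "mids q n N \<subseteq> set (word q n N)"
  by (auto simp: mids_def set_word set_seg)

lemma finite_mids: "finite (mids q n N)"
  using mids_subset_word by (rule finite_subset) simp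

lemma concat_map_split:
  assumes "x \<in> set xs"
  shows "\<exists>us vs. concat (map f xs) = us @ f x @ vs"
proof -
  from assms obtain as bs where "xs = as @ x # bs" by (meson split_list)
  then show ?thesis by (metis concat.simps(2) concat_append list.simps(9) map_append)
qed

lemma word_split_seg:
  assumes "i < q" "k < N"
  shows "\<exists>us vs. word q n N = us @ seg n i k @ vs"
proof -
  obtain us vs where "concat (map (seg n i) [0..<N]) = us @ seg n i k @ vs"
    using concat_map_split[of k "[0..<N]" "seg n i"] assms by auto
  moreover obtain us' vs' where
    "word q n N = us' @ (concat (map (seg n i) [0..<N]) @ [Lnk i]) @ vs'"
    unfolding word_def
    using concat_map_split[of i "[0..<q]" "\<lambda>i. concat (map (seg n i) [0..<N]) @ [Lnk i]"] assms by auto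
  ultimately have "word q n N = (us' @ us) @ seg n i k @ (vs @ [Lnk i] @ vs')" by simp
  then show ?thesis by blast
qed

lemma word_split_triple:
  assumes "i < q" "k < N" "p < n i" "r < n i"
  shows "\<exists>us vs. word q n N = us @ [Lft k i p r, Mid k i p r, Rgt k i p r] @ vs"
proof -
  have "(p, r) \<in> set (List.product [0..<n i] [0..<n i])" using assms by simp
  from concat_map_split[OF this, of "\<lambda>(p, r). [Lft k i p r, Mid k i p r, Rgt k i p r]"]
  obtain us vs where "seg n i k = us @ [Lft k i p r, Mid k i p r, Rgt k i p r] @ vs"
    unfolding seg_def by auto
  moreover obtain us' vs' where "word q n N = us' @ seg n i k @ vs'"
    using word_split_seg assms by blast
  ultimately have "word q n N = (us' @ us) @ [Lft k i p r, Mid k i p r, Rgt k i p r] @ (vs @ vs')"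
    by simp
  then show ?thesis by blast
qed

section \<open>Evaluation on matrix units\<close>

definition matrix_units :: "nat \<Rightarrow> (nat \<Rightarrow> nat) \<Rightarrow> (nat \<Rightarrow> nat \<Rightarrow> nat \<Rightarrow> 'a::ring) \<Rightarrow> bool" where
  "matrix_units q n e \<longleftrightarrow> (\<forall>i<q. 0 < n i) \<and> (\<forall>i<q. \<forall>p<n i. \<forall>r<n i. e i p r \<noteq> 0) \<and>
     (\<forall>i<q. \<forall>p<n i. \<forall>r<n i. \<forall>i'<q. \<forall>p'<n i'. \<forall>r'<n i'.
        e i p r * e i' p' r' = (if i = i' \<and> r = p' then e i p r' else 0))"

definition unit_set :: "(nat \<Rightarrow> nat) \<Rightarrow> (nat \<Rightarrow> nat \<Rightarrow> nat \<Rightarrow> 'a) \<Rightarrow> nat \<Rightarrow> 'a set" where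
  "unit_set n e i = {e i p r |p r. p < n i \<and> r < n i}"

lemma matrix_units_mult:
  assumes "matrix_units q n e" "i < q" "p < n i" "r < n i" "i' < q" "p' < n i'" "r' < n i'"
  shows "e i p r * e i' p' r' = (if i = i' \<and> r = p' then e i p r' else 0)"
  using assms unfolding matrix_units_def by blast

text \<open>Every triple has product \<open>e i 0 0\<close>, so a segment acts trivially on whatever
  \<open>e i 0 0\<close> fixes. The link values \<open>g\<close> stay free.\<close>

primrec unit_eval :: "(nat \<Rightarrow> nat \<Rightarrow> nat \<Rightarrow> 'a) \<Rightarrow> (nat \<Rightarrow> 'a) \<Rightarrow> var \<Rightarrow> 'a" where
  "unit_eval e g (Lft k i p r) = e i 0 p"
| "unit_eval e g (Mid k i p r) = e i p r"
| "unit_eval e g (Rgt k i p r) = e i r 0"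
| "unit_eval e g (Lnk i) = g i"

text \<open>Read as successive left multiplications, the front part may be empty.\<close>

lemma prodl_append_foldr: "ys \<noteq> [] \<Longrightarrow> prodl (xs @ ys) = foldr (*) xs (prodl ys)"
  by (induction xs) (auto simp: prodl_Cons)

lemma foldr_concat_fixed:
  assumes "\<And>xs. xs \<in> set xss \<Longrightarrow> foldr (*) xs z = (z::'a::ring)"
  shows "foldr (*) (concat xss) z = z"
  using assms by (induction xss) auto

lemma foldr_seg:
  assumes "matrix_units q n e" "i < q" "e i 0 0 * z = z"
  shows "foldr (*) (map (unit_eval e g) (seg n i k)) z = z"
proof -
  have "e i 0 p * (e i p r * (e i r 0 * z)) = z" if "p < n i" "r < n i" for p r
  proof -
    have "e i 0 p * (e i p r * (e i r 0 * z)) = (e i 0 p * e i p r) * e i r 0 * z"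
      by (simp add: mult.assoc)
    also have "\<dots> = e i 0 0 * z"
      using that assms(2) by (simp add: matrix_units_mult[OF assms(1)])
    finally show ?thesis using assms(3) by simp
  qed
  then show ?thesis
    unfolding seg_def map_concat by (intro foldr_concat_fixed) auto
qed

text \<open>The segments before \<open>Lnk i\<close> act trivially on \<open>g i\<close> times the
  rest, so only the links survive. The list \<open>js\<close> is arbitrary to allow
  induction.\<close>

lemma prodl_word:
  assumes mu: "matrix_units q n e" and g: "\<And>i. i < q \<Longrightarrow> e i 0 0 * g i = g i"
    and "js \<noteq> []" "set js \<subseteq> {..<q}"
  shows "prodl (map (unit_eval e g)
      (concat (map (\<lambda>i. concat (map (seg n i) [0..<N]) @ [Lnk i]) js))) = prodl (map g js)"
  using assms(3-)
proof (induction js)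
  case (Cons i js)
  let ?v = "unit_eval e g" and ?S = "concat (map (seg n i) [0..<N])"
  let ?C = "\<lambda>js. concat (map (\<lambda>i. concat (map (seg n i) [0..<N]) @ [Lnk i]) js)"
  have i: "i < q" using Cons.prems by simp
  have "prodl (map ?v (?C (i # js))) = foldr (*) (map ?v ?S) (prodl (g i # map ?v (?C js)))"
    using prodl_append_foldr[of "g i # map ?v (?C js)" "map ?v ?S"] by simp
  also have "prodl (g i # map ?v (?C js)) = prodl (map g (i # js))"
  proof (cases "js = []")
    case False
    then have "?C js \<noteq> []" by (cases js) auto
    with False Cons show ?thesis by (simp add: prodl_Cons)
  qed simp
  also have "foldr (*) (map ?v ?S) (prodl (map g (i # js))) = prodl (map g (i # js))"
  proof -
    have "e i 0 0 * prodl (map g (i # js)) = prodl (map g (i # js))"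
      using g[OF i] by (cases "js = []") (auto simp: prodl_Cons mult.assoc[symmetric])
    then show ?thesis
      unfolding map_concat by (intro foldr_concat_fixed) (auto intro: foldr_seg[OF mu i])
  qed
  finally show ?case .
qed simp

text \<open>A permutation other than the identity moves some \<open>Mid\<close> variable, and the
  fixed neighbours annihilate its new value. The remaining term collapses to its links.\<close>

lemma altsum_word_unit_eval:
  assumes "vector_space sm" and mu: "matrix_units q n e"
    and g: "\<And>i. i < q \<Longrightarrow> e i 0 0 * g i = g i" and "q > 0"
  shows "altsum sm (word_perms q n N) (word q n N) (unit_eval e g) = prodl (map g [0..<q])"
proof -
  interpret vector_space sm by fact
  let ?G = "word_perms q n N" and ?v = "unit_eval e g" and ?w = "word q n N"
  have zero: "prodl (map (?v \<circ> \<pi>) ?w) = 0" if "\<pi> \<in> ?G" "\<pi> \<noteq> id" for \<pi>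
  proof -
    have perm: "\<pi> permutes mids q n N" and blk: "\<And>v. blk (\<pi> v) = blk v"
      using that(1) by (auto simp: block_perms_def)
    from that(2) obtain v where "\<pi> v \<noteq> v" by (auto simp: fun_eq_iff)
    then have "v \<in> mids q n N" using perm by (metis permutes_not_in)
    then obtain k i p r where v: "v = Mid k i p r" and b: "k < N" "i < q" "p < n i" "r < n i"
      by (auto simp: mids_def)
    have "\<pi> v \<in> mids q n N" using \<open>v \<in> mids q n N\<close> perm by (simp add: permutes_in_image)
    then obtain i' p' r' where v': "\<pi> v = Mid k i' p' r'" and b': "i' < q" "p' < n i'" "r' < n i'"
      using blk[of v] by (auto simp: mids_def v)
    have ne: "\<not> (i' = i \<and> p' = p \<and> r' = r)" using \<open>\<pi> v \<noteq> v\<close> v v' by auto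
    have fixed: "\<pi> (Lft k i p r) = Lft k i p r" "\<pi> (Rgt k i p r) = Rgt k i p r"
      using perm by (auto intro!: permutes_not_in[of \<pi>] simp: mids_def)
    obtain us vs where w: "?w = us @ [Lft k i p r, Mid k i p r, Rgt k i p r] @ vs"
      using word_split_triple[of i q k N p n r] b by blast
    have "0 < n i" using b by simp
    then have "e i 0 p * (e i' p' r' * e i r 0) = 0"
      using ne b b' by (auto simp: matrix_units_mult[OF mu])
    then have "prodl (map (?v \<circ> \<pi>) [Lft k i p r, Mid k i p r, Rgt k i p r]) = 0"
      using v v' fixed by simp
    then show ?thesis
      unfolding w map_append by (intro prodl_sublist_zero) auto
  qed
  have "altsum sm ?G ?w ?v = (\<Sum>\<pi>\<in>{id}. sm (of_int (sign \<pi>)) (prodl (map (?v \<circ> \<pi>) ?w)))"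
    unfolding altsum_def using zero
    by (intro sum.mono_neutral_right finite_block_perms finite_mids)
      (auto simp: block_perms_def permutes_id)
  also have "\<dots> = prodl (map g [0..<q])"
    using prodl_word[OF mu g, of "[0..<q]" N] assms(4) by (auto simp: word_def lessThan_atLeast0)
  finally show ?thesis .
qed

text \<open>Neighbouring units from different components have product zero.\<close>

lemma prodl_units_same_component:
  assumes mu: "matrix_units q m e"
  shows "xs \<noteq> [] \<Longrightarrow> prodl xs \<noteq> 0 \<Longrightarrow> set xs \<subseteq> (\<Union>j<q. unit_set m e j) \<Longrightarrow>
    \<exists>j<q. set xs \<subseteq> unit_set m e j"
proof (induction xs)
  case (Cons x xs)
  show ?case
  proof (cases xs)
    case Nil
    with Cons.prems show ?thesis by auto
  next
    case (Cons y ys)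
    with Cons.prems have "prodl xs \<noteq> 0" by auto
    with Cons Cons.IH Cons.prems obtain j where j: "j < q" "set xs \<subseteq> unit_set m e j" by auto
    have "x * y \<noteq> 0"
    proof
      assume *: "x * y = 0"
      have "x * (y * z) = 0" for z using * by (simp add: mult.assoc[symmetric])
      with * Cons Cons.prems(2) show False by (cases ys) auto
    qed
    moreover from Cons.prems obtain j' p r where
      x: "j' < q" "p < m j'" "r < m j'" "x = e j' p r" by (auto simp: unit_set_def)
    moreover from j Cons obtain p' r' where
      "p' < m j" "r' < m j" "y = e j p' r'" by (auto simp: unit_set_def)
    ultimately have "j' = j"
      using j(1) matrix_units_mult[OF mu, of j' p r j p' r'] by (metis (full_types))
    with j x show ?thesis by (intro exI[of _ j]) (auto simp: unit_set_def)
  qed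
qed simp

text \<open>Here \<open>h i\<close> is the component in which the \<open>i\<close>-th segment of a
  radical-free block takes its values. The designated variables of that block sent to component
  \<open>j\<close> take distinct values among at most \<open>m j * m j\<close> units.\<close>

lemma altsum_word_bound:
  fixes sm :: "'k::field_char_0 \<Rightarrow> 'a::ring \<Rightarrow> 'a"
  assumes "algebra sm" and mu: "matrix_units q' m e"
    and span: "module.span sm (J \<union> (\<Union>j<q'. unit_set m e j)) = UNIV"
    and nil: "\<And>xs. N \<le> length (filter (\<lambda>x. x \<in> J) xs) \<Longrightarrow> prodl xs = 0"
    and pos: "\<And>i. i < q \<Longrightarrow> 0 < n i"
    and nz: "altsum sm (word_perms q n N) (word q n N) x \<noteq> 0"
  shows "\<exists>h. (\<forall>i<q. h i < q') \<and> (\<forall>j<q'. (\<Sum>i | i < q \<and> h i = j. n i * n i) \<le> m j * m j)"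
proof -
  interpret algebra sm by fact
  let ?w = "word q n N" and ?G = "word_perms q n N" and ?U = "\<Union>j<q'. unit_set m e j"
  obtain y where y: "\<And>v. v \<in> set ?w \<Longrightarrow> y v \<in> J \<union> ?U" and ynz: "altsum sm ?G ?w y \<noteq> 0"
    using altsum_nonzero_on_spanning[OF distinct_word mids_subset_word nz span] by blast
  \<comment> \<open>Two permuted variables of one block with a common value would annihilate the
    alternating sum.\<close>
  have inj: "u = v" if "u \<in> mids q n N" "v \<in> mids q n N" "blk u = blk v" "y u = y v" for u v
    using altsum_collision[OF vector_space_axioms finite_mids that(1,2) _ that(3,4)] ynz by blast
  obtain \<pi> where \<pi>: "\<pi> \<in> ?G" and prod: "prodl (map (y \<circ> \<pi>) ?w) \<noteq> 0"
    using ynz unfolding altsum_def by (metis (no_types, lifting) scale_zero_right sum.neutral)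
  have perm: "\<pi> permutes mids q n N" and blk: "\<And>v. blk (\<pi> v) = blk v"
    using \<pi> by (auto simp: block_perms_def)
  have perm_w: "\<pi> v \<in> set ?w" if "v \<in> set ?w" for v
    using that permutes_subset[OF perm mids_subset_word] by (simp add: permutes_in_image)
  \<comment> \<open>The variables whose position carries a radical value in the chosen summand; by
    nilpotency there are fewer than \<open>N\<close> of them.\<close>
  define V where "V = {v \<in> set ?w. y (\<pi> v) \<in> J}"
  have "card V = length (filter (\<lambda>x. x \<in> J) (map (y \<circ> \<pi>) ?w))"
    unfolding V_def
    using distinct_card[OF distinct_filter[OF distinct_word], of "\<lambda>v. y (\<pi> v) \<in> J" q n N]
    by (simp add: filter_map comp_def)
  then have "card V < N" using nil prod by (metis not_le_imp_less)
  moreover have "finite V" by (simp add: V_def)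
  ultimately have "card (blk ` V) < card (Some ` {..<N})"
    using card_image_le[of V blk] by (simp add: card_image)
  then have "\<not> Some ` {..<N} \<subseteq> blk ` V"
    using card_mono[of "blk ` V" "Some ` {..<N}"] \<open>finite V\<close> by auto
  \<comment> \<open>There are more blocks than radical values in a nonzero product.\<close>
  then obtain k where k: "k < N" "Some k \<notin> blk ` V" by blast
  have in_U: "y (\<pi> v) \<in> ?U" if "v \<in> set ?w" "blk v = Some k" for v
  proof -
    have "v \<notin> V" using k(2) that(2) by (metis image_eqI)
    with that(1) y[OF perm_w[OF that(1)]] show ?thesis by (auto simp: V_def)
  qed
  have "\<exists>j<q'. set (map (y \<circ> \<pi>) (seg n i k)) \<subseteq> unit_set m e j" if "i < q" for i
  proof -
    obtain us vs where w: "?w = us @ seg n i k @ vs" using word_split_seg[of i q k N n] \<open>i < q\<close> k(1) by blast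
    have "Mid k i 0 0 \<in> set (seg n i k)" using pos[OF that] by (auto simp: set_seg)
    then have ne: "map (y \<circ> \<pi>) (seg n i k) \<noteq> []" by auto
    show ?thesis
    proof (rule prodl_units_same_component[OF mu ne])
      show "prodl (map (y \<circ> \<pi>) (seg n i k)) \<noteq> 0"
        using prod prodl_sublist_zero[OF ne] unfolding w map_append by blast
      have "v \<in> set ?w \<and> blk v = Some k" if "v \<in> set (seg n i k)" for v
        using that w by (auto simp: set_seg)
      then show "set (map (y \<circ> \<pi>) (seg n i k)) \<subseteq> ?U" using in_U by auto
    qed
  qed
  then obtain h where h: "\<And>i. i < q \<Longrightarrow> h i < q'"
      "\<And>i v. i < q \<Longrightarrow> v \<in> set (seg n i k) \<Longrightarrow> y (\<pi> v) \<in> unit_set m e (h i)"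
    by (metis (no_types, lifting) comp_apply image_subset_iff list.set_map)
  have "(\<Sum>i | i < q \<and> h i = j. n i * n i) \<le> m j * m j" if "j < q'" for j
  proof -
    \<comment> \<open>The index triples of the designated variables of block \<open>k\<close> whose
      segments fall into component \<open>j\<close>.\<close>
    define K where "K = (SIGMA i:{i. i < q \<and> h i = j}. {..<n i} \<times> {..<n i})"
    let ?f = "\<lambda>(i, p, r). y (\<pi> (Mid k i p r))"
    have "inj_on ?f K"
    proof (rule inj_onI)
      fix s t assume K: "s \<in> K" "t \<in> K" and eq: "?f s = ?f t"
      obtain i p r i' p' r' where st: "s = (i, p, r)" "t = (i', p', r')" by (metis prod_cases3)
      have "Mid k i p r \<in> mids q n N" "Mid k i' p' r' \<in> mids q n N"
        using K k(1) by (auto simp: K_def mids_def st)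
      then have "\<pi> (Mid k i p r) = \<pi> (Mid k i' p' r')"
        using eq perm by (intro inj) (auto simp: permutes_in_image blk st)
      then have "Mid k i p r = Mid k i' p' r'" using permutes_inj[OF perm] by (simp add: inj_eq)
      then show "s = t" by (simp add: st)
    qed
    moreover have "?f ` K \<subseteq> unit_set m e j"
      using h(2) by (fastforce simp: K_def set_seg)
    moreover have us: "unit_set m e j = (\<lambda>(p, r). e j p r) ` ({..<m j} \<times> {..<m j})"
      by (auto simp: unit_set_def)
    ultimately have "card K \<le> card (unit_set m e j)"
      by (intro card_inj_on_le[of ?f]) auto
    also have "\<dots> \<le> m j * m j"
      unfolding us using card_image_le[of "{..<m j} \<times> {..<m j}" "\<lambda>(p, r). e j p r"]
      by (simp add: card_cartesian_product)
    also have "card K = (\<Sum>i | i < q \<and> h i = j. n i * n i)"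
      unfolding K_def by (subst card_SigmaI) auto
    finally show ?thesis .
  qed
  with h(1) show ?thesis by blast
qed

section \<open>Full algebras\<close>

lemma jprod_cong: "(\<And>i. i < q \<Longrightarrow> a i = b i) \<Longrightarrow> jprod a j q = jprod b j q"
  by (induction a j q rule: jprod.induct) auto

lemma jprod_add_coord:
  "v < q \<Longrightarrow> jprod (a(v := x + y)) j q = jprod (a(v := x)) j q + jprod (a(v := y)) j q"
proof (induction a j q rule: jprod.induct)
  case (3 a j n)
  show ?case
  proof (cases "v = Suc n")
    case True
    then have "jprod (a(v := z)) j (Suc n) = jprod a j (Suc n)" for z by (intro jprod_cong) auto
    then have "jprod (a(v := z)) j (Suc (Suc n)) = jprod a j (Suc n) * j n * z" for z
      by (simp only: jprod.simps True fun_upd_same)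
    then show ?thesis by (simp only: distrib_left)
  next
    case False
    with 3 show ?thesis by (simp add: distrib_right)
  qed
qed auto

lemma (in algebra) jprod_scale_coord:
  "v < q \<Longrightarrow> jprod (a(v := sm c x)) j q = sm c (jprod (a(v := x)) j q)"
proof (induction a j q rule: jprod.induct)
  case (3 a j n)
  show ?case
  proof (cases "v = Suc n")
    case True
    then have "jprod (a(v := z)) j (Suc n) = jprod a j (Suc n)" for z by (intro jprod_cong) auto
    then have "jprod (a(v := z)) j (Suc (Suc n)) = jprod a j (Suc n) * j n * z" for z
      by (simp only: jprod.simps True fun_upd_same)
    then show ?thesis by (simp only: scale_mult_right)
  next
    case False
    with 3 show ?thesis by (simp add: scale_mult_left)
  qed
qed auto

lemma foldr_mult_right: "foldr (*) xs z * w = foldr (*) xs (z * w :: 'a::ring)"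
  by (induction xs) (auto simp: mult.assoc)

text \<open>By multilinearity the factors \<open>a i\<close> may be taken to be matrix units. Each
  is split through index \<open>0\<close>, and its right half is grouped with the radical element
  and the left half of the next unit, so that each group begins with row \<open>0\<close> as a link
  value must.\<close>

lemma (in algebra) full_chain:
  assumes mu: "matrix_units q n e" and "q > 0"
    and a: "\<And>i. i < q \<Longrightarrow> a i \<in> span (unit_set n e i)" and nz: "jprod a j q \<noteq> 0"
  shows "\<exists>g. (\<forall>i<q. e i 0 0 * g i = g i) \<and> prodl (map g [0..<q]) \<noteq> 0"
proof -
  have "\<exists>y. (\<forall>v\<in>{..<q}. y v \<in> unit_set n e v) \<and> (\<forall>v. v \<notin> {..<q} \<longrightarrow> y v = a v) \<and> jprod y j q \<noteq> 0"
    by (rule multilinear_nonzero_on_spanning[OF vector_space_axioms])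
      (use a nz in \<open>auto simp: jprod_add_coord jprod_scale_coord\<close>)
  then obtain y where y: "\<And>i. i < q \<Longrightarrow> y i \<in> unit_set n e i" "jprod y j q \<noteq> 0" by auto
  then obtain P R where PR: "\<And>i. i < q \<Longrightarrow> P i < n i \<and> R i < n i \<and> y i = e i (P i) (R i)"
    unfolding unit_set_def mem_Collect_eq by metis
  have n0: "0 < n i" if "i < q" for i using mu that by (simp add: matrix_units_def)
  have split: "y i = e i (P i) 0 * e i 0 (R i)" "e i 0 0 * e i 0 (R i) = e i 0 (R i)" if "i < q" for i
    using that PR n0 by (auto simp: matrix_units_mult[OF mu])
  define G where "G i = e i 0 (R i) * j i * e (Suc i) (P (Suc i)) 0" for i
  have chain: "jprod y j (Suc k) = e 0 (P 0) 0 * foldr (*) (map G [0..<k]) (e k 0 (R k))" if "k < q" for k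
    using that
  proof (induction k)
    case 0
    then show ?case using split by simp
  next
    case (Suc k)
    have "jprod y j (Suc (Suc k)) = jprod y j (Suc k) * j k * y (Suc k)" by simp
    also have "\<dots> = e 0 (P 0) 0 * foldr (*) (map G [0..<k]) (G k * e (Suc k) 0 (R (Suc k)))"
      using Suc split(1)[OF Suc.prems] by (simp add: mult.assoc foldr_mult_right G_def[of k])
    finally show ?case by simp
  qed
  obtain k where k: "q = Suc k" using \<open>q > 0\<close> by (cases q) auto
  define g where "g i = (if i < k then G i else e i 0 (R i))" for i
  have "map g [0..<q] = map G [0..<k] @ [e k 0 (R k)]" by (simp add: k g_def)
  then have "prodl (map g [0..<q]) = foldr (*) (map G [0..<k]) (e k 0 (R k))"
    using prodl_append_foldr[of "[e k 0 (R k)]" "map G [0..<k]"] by simp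
  then have "prodl (map g [0..<q]) \<noteq> 0" using chain[of k] y(2) k by auto
  moreover have "e i 0 0 * g i = g i" if "i < q" for i
    using split(2)[OF that] by (simp add: g_def G_def mult.assoc[symmetric])
  ultimately show ?thesis by blast
qed

text \<open>Matrix units are chosen in each component separately; across components they are
  orthogonal because the components are.\<close>

lemma (in fin_dim_algebra) wm_decomp_matrix_units:
  assumes ac: "alg_closed_field TYPE('k)" and wm: "wm_decomp sm S q C"
  shows "\<exists>n e. matrix_units q n e \<and> (\<forall>i<q. C i = span (unit_set n e i)) \<and>
    S = span (\<Union>i<q. unit_set n e i)"
proof -
  note wm' = wm[unfolded wm_decomp_def subalg_def]
  have simple: "\<And>i. i < q \<Longrightarrow> simple_alg sm (C i)" using wm' by blast
  have orth: "\<And>i k x y. i < q \<Longrightarrow> k < q \<Longrightarrow> i \<noteq> k \<Longrightarrow> x \<in> C i \<Longrightarrow> y \<in> C k \<Longrightarrow> x * y = 0"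
    using wm' by (elim conjE) blast
  have sums: "\<And>c. (\<forall>i<q. c i \<in> C i) \<Longrightarrow> (\<Sum>i<q. c i) \<in> S" using wm' by (elim conjE) blast
  have dec: "\<exists>c. (\<forall>i<q. c i \<in> C i) \<and> s = (\<Sum>i<q. c i)" if "s \<in> S" for s
  proof -
    have "\<exists>!c. (\<forall>i<q. c i \<in> C i) \<and> (\<forall>i\<ge>q. c i = 0) \<and> s = (\<Sum>i<q. c i)"
      using wm' that by (elim conjE) (rule bspec)
    then show ?thesis by (elim ex1E) blast
  qed
  have S: "subspace S" using wm' by (elim conjE)
  define P where "P i n e \<longleftrightarrow> 0 < (n::nat) \<and> (\<forall>p<n. \<forall>r<n. e p r \<noteq> 0) \<and>
     (\<forall>p<n. \<forall>r<n. \<forall>p'<n. \<forall>r'<n. e p r * e p' r' = (if r = p' then e p r' else 0)) \<and>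
     C i = span {e p r |p r. p < n \<and> r < n}" for i n e
  have "\<exists>n e. P i n e" if "i < q" for i
    unfolding P_def by (rule simple_alg_matrix_units[OF ac simple[OF that]])
  then obtain n e where P: "\<And>i. i < q \<Longrightarrow> P i (n i) (e i)" by metis
  have C: "C i = span (unit_set n e i)" if "i < q" for i
    using P[OF that] by (simp add: P_def unit_set_def)
  have mem: "e i p r \<in> C i" if "i < q" "p < n i" "r < n i" for i p r
    using that C by (auto simp: unit_set_def intro: span_base)
  have "matrix_units q n e"
    unfolding matrix_units_def
  proof (intro conjI allI impI)
    fix i p r i' p' r' assume *: "i < q" "p < n i" "r < n i" "i' < q" "p' < n i'" "r' < n i'"
    show "e i p r * e i' p' r' = (if i = i' \<and> r = p' then e i p r' else 0)"
    proof (cases "i = i'")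
      case True
      with P[OF *(1)] * show ?thesis by (simp add: P_def)
    next
      case False
      with orth[OF *(1,4) False mem mem] * show ?thesis by simp
    qed
  qed (use P in \<open>auto simp: P_def\<close>)
  moreover have "S = span (\<Union>i<q. unit_set n e i)"
  proof
    show "S \<subseteq> span (\<Union>i<q. unit_set n e i)"
    proof
      fix s assume "s \<in> S"
      then obtain c where c: "\<forall>i<q. c i \<in> C i" "s = (\<Sum>i<q. c i)" using dec by blast
      have "c i \<in> span (\<Union>i<q. unit_set n e i)" if "i < q" for i
        using span_mono[of "unit_set n e i" "\<Union>i<q. unit_set n e i"] c(1) C that by blast
      then show "s \<in> span (\<Union>i<q. unit_set n e i)" unfolding c(2) by (intro span_sum) auto
    qed
    have "x \<in> S" if x: "x \<in> unit_set n e i" and i: "i < q" for x i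
    proof -
      have "0 \<in> C k" if "k < q" for k using C[OF that] span_zero by simp
      moreover have "x \<in> C i" using C[OF i] x span_base by blast
      ultimately have "(\<Sum>k<q. if k = i then x else 0) \<in> S" by (intro sums) auto
      with i show ?thesis by simp
    qed
    then show "span (\<Union>i<q. unit_set n e i) \<subseteq> S" by (intro span_minimal S) auto
  qed
  ultimately show ?thesis using C by blast
qed

text \<open>Fullness makes the test word nonzero on \<open>sa\<close>; the inclusion of identities
  carries this to \<open>sb\<close>, where the bound applies. The theorem uses this in both
  directions.\<close>

lemma full_component_sizes:
  fixes sa :: "'k::field_char_0 \<Rightarrow> 'a::ring \<Rightarrow> 'a" and sb :: "'k \<Rightarrow> 'b::ring \<Rightarrow> 'b"
  assumes A: "algebra sa" and B: "fin_dim_algebra sb Basis"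
    and Id: "PI_Id sb \<subseteq> PI_Id sa"
    and muA: "matrix_units q n e" "q > 0"
    and full: "\<And>i. i < q \<Longrightarrow> a i \<in> module.span sa (unit_set n e i)" "jprod a j q \<noteq> 0"
    and muB: "matrix_units q' m e'"
    and wm: "wm_decomp sb S' q' C'" and S': "S' = module.span sb (\<Union>i<q'. unit_set m e' i)"
  shows "\<exists>h. (\<forall>i<q. h i < q') \<and> (\<forall>j<q'. (\<Sum>i | i < q \<and> h i = j. n i * n i) \<le> m j * m j)"
proof -
  interpret A: algebra sa by fact
  interpret B: fin_dim_algebra sb Basis by fact
  \<comment> \<open>The number of blocks is dictated by the radical of \<open>sb\<close>, where the
    word is to be bounded.\<close>
  obtain N where nil: "\<And>xs. N \<le> length (filter (\<lambda>x. x \<in> jac sb) xs) \<Longrightarrow> prodl xs = 0"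
    using B.prodl_nilpotent B.jac_nilpotent_ideal by metis
  obtain g where g: "\<And>i. i < q \<Longrightarrow> e i 0 0 * g i = g i" "prodl (map g [0..<q]) \<noteq> 0"
    using A.full_chain[OF muA full] by blast
  have "altsum sa (word_perms q n N) (word q n N) (unit_eval e g) \<noteq> 0"
    using altsum_word_unit_eval[OF A.vector_space_axioms muA(1) g(1) muA(2)] g(2) by simp
  moreover have "word q n N \<noteq> []" using muA(2) by (auto simp: word_def)
  ultimately obtain x where x: "altsum sb (word_perms q n N) (word q n N) x \<noteq> 0"
    using altsum_transfer[OF A.vector_space_axioms B.vector_space_axioms Id
        finite_block_perms[OF finite_mids]] by blast
  have "B.span (jac sb \<union> (\<Union>i<q'. unit_set m e' i)) = UNIV" (is "B.span ?E = _")
  proof -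
    have "b \<in> B.span ?E" for b
    proof -
      have "\<exists>s\<in>S'. \<exists>t\<in>jac sb. b = s + t" using wm unfolding wm_decomp_def by (elim conjE) (rule spec)
      then obtain s t where "s \<in> S'" "t \<in> jac sb" "b = s + t" by blast
      moreover have "S' \<subseteq> B.span ?E" unfolding S' by (intro B.span_mono) auto
      ultimately show ?thesis by (auto intro!: B.span_add intro: B.span_base)
    qed
    then show ?thesis by blast
  qed
  from altsum_word_bound[OF B.algebra_axioms muB this nil _ x] muA(1)
  show ?thesis by (simp add: matrix_units_def)
qed

text \<open>Summed over all components, the two families of inequalities give equal totals, so each
  inequality is an equality. As sizes are positive, \<open>h\<close> and \<open>h'\<close> are
  surjective; hence \<open>h\<close> is bijective, its fibres are singletons and the sizes
  agree.\<close>

lemma component_matching: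
  fixes n m :: "nat \<Rightarrow> nat"
  assumes h: "\<forall>i<q. h i < q'" "\<forall>j<q'. (\<Sum>i | i < q \<and> h i = j. n i * n i) \<le> m j * m j"
    and h': "\<forall>j<q'. h' j < q" "\<forall>i<q. (\<Sum>j | j < q' \<and> h' j = i. m j * m j) \<le> n i * n i"
    and pos: "\<forall>i<q. 0 < n i" "\<forall>j<q'. 0 < m j"
  shows "bij_betw h {..<q} {..<q'} \<and> (\<forall>i<q. n i = m (h i))"
proof -
  have grp: "(\<Sum>j<q'. \<Sum>i | i < q \<and> h i = j. n i * n i) = (\<Sum>i<q. n i * n i)"
    if "\<forall>i<q. h i < q'" for q q' and h n :: "nat \<Rightarrow> nat"
    using sum.group[of "{..<q}" "{..<q'}" h "\<lambda>i. n i * n i"] that by auto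
  have "(\<Sum>i<q. n i * n i) \<le> (\<Sum>j<q'. m j * m j)"
    unfolding grp[OF h(1), symmetric] using h(2) by (intro sum_mono) auto
  moreover have "(\<Sum>j<q'. m j * m j) \<le> (\<Sum>i<q. n i * n i)"
    unfolding grp[OF h'(1), symmetric] using h'(2) by (intro sum_mono) auto
  ultimately have tot: "(\<Sum>i<q. n i * n i) = (\<Sum>j<q'. m j * m j)" by simp
  have eq: "(\<Sum>i | i < q \<and> h i = j. n i * n i) = m j * m j" if "j < q'" for j
    using h(2) that grp[OF h(1)] tot by (intro sum_mono_inv[of _ "{..<q'}" "\<lambda>j. m j * m j"]) auto
  have eq': "(\<Sum>j | j < q' \<and> h' j = i. m j * m j) = n i * n i" if "i < q" for i
    using h'(2) that grp[OF h'(1)] tot by (intro sum_mono_inv[of _ "{..<q}" "\<lambda>j. n j * n j"]) auto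
  have surj: "{..<q'} = h ` {..<q}"
  proof
    show "{..<q'} \<subseteq> h ` {..<q}"
    proof
      fix j assume j: "j \<in> {..<q'}"
      then have "{i. i < q \<and> h i = j} \<noteq> {}" using eq[of j] pos(2) by force
      then show "j \<in> h ` {..<q}" by auto
    qed
  qed (use h in auto)
  have surj': "{..<q} = h' ` {..<q'}"
  proof
    show "{..<q} \<subseteq> h' ` {..<q'}"
    proof
      fix i assume i: "i \<in> {..<q}"
      then have "{j. j < q' \<and> h' j = i} \<noteq> {}" using eq'[of i] pos(1) by force
      then show "i \<in> h' ` {..<q'}" by auto
    qed
  qed (use h' in auto)
  have "card {..<q'} \<le> card {..<q}" unfolding surj by (rule card_image_le) simp
  moreover have "card {..<q} \<le> card {..<q'}" unfolding surj' by (rule card_image_le) simp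
  ultimately have "card (h ` {..<q}) = card {..<q}" unfolding surj[symmetric] by simp
  then have inj: "inj_on h {..<q}" by (intro eq_card_imp_inj_on) auto
  have "n i = m (h i)" if "i < q" for i
  proof -
    have "{i'. i' < q \<and> h i' = h i} = {i}" using inj that by (auto simp: inj_on_def)
    then have "n i * n i = m (h i) * m (h i)" using eq[of "h i"] h(1) that by simp
    then show ?thesis by (metis power2_eq_square power2_eq_iff_nonneg zero_le)
  qed
  then show ?thesis using inj surj by (simp add: bij_betw_def)
qed

section \<open>Isomorphisms\<close>

text \<open>Diagonal units on both sides extract a single matrix coefficient. Distinctness and
  linear independence of the units rest on this.\<close>

lemma matrix_units_sandwich:
  assumes mu: "matrix_units q n e"
    and "i < q" "p < n i" "r < n i" "i' < q" "p' < n i'" "r' < n i'"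
  shows "e i p p * (e i' p' r' * e i r r) = (if i = i' \<and> p = p' \<and> r = r' then e i p r else 0)"
  using assms by (auto simp: matrix_units_mult[OF mu])

lemma matrix_units_inj:
  assumes mu: "matrix_units q n e"
    and "i < q" "p < n i" "r < n i" "i' < q" "p' < n i'" "r' < n i'" "e i p r = e i' p' r'"
  shows "i = i' \<and> p = p' \<and> r = r'"
proof -
  have "e i p r \<noteq> 0" using mu assms(2-4) by (simp add: matrix_units_def)
  then show ?thesis
    using matrix_units_sandwich[OF mu assms(2-4) assms(2-4)]
      matrix_units_sandwich[OF mu assms(2-7)] assms(8) by (metis (full_types))
qed

text \<open>The sandwich belonging to a unit kills all other units, hence their span, but fixes that
  unit.\<close>

lemma (in algebra) independent_matrix_units:
  assumes mu: "matrix_units q n e"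
  shows "independent (\<Union>i<q. unit_set n e i)" (is "independent ?B")
proof
  assume "dependent ?B"
  then obtain b where b: "b \<in> ?B" "b \<in> span (?B - {b})" unfolding dependent_def by blast
  then obtain i p r where i: "i < q" "p < n i" "r < n i" "b = e i p r" by (auto simp: unit_set_def)
  let ?T = "{x. e i p p * (x * e i r r) = 0}"
  have "subspace ?T"
    by (auto intro!: subspaceI simp: distrib_left distrib_right scale_mult_left scale_mult_right)
  moreover have "?B - {b} \<subseteq> ?T"
    using i by (auto simp: unit_set_def matrix_units_sandwich[OF mu])
  ultimately have "b \<in> ?T" using b(2) span_minimal by blast
  then have "e i p r = 0" using i matrix_units_sandwich[OF mu i(1-3) i(1-3)] by simp
  then show False using mu i by (simp add: matrix_units_def)
qed

text \<open>The linear extension of \<open>e i p r\<close> \<mapsto> \<open>e' (h i) p r\<close>. It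
  carries a basis bijectively to a basis, and multiplicativity passes from units to spans one
  argument at a time.\<close>

lemma matrix_units_iso:
  fixes sa :: "'k::field \<Rightarrow> 'a::ring \<Rightarrow> 'a" and sb :: "'k \<Rightarrow> 'b::ring \<Rightarrow> 'b"
  assumes A: "algebra sa" and B: "algebra sb"
    and mu: "matrix_units q n e" and mu': "matrix_units q' m e'"
    and h: "bij_betw h {..<q} {..<q'}" "\<And>i. i < q \<Longrightarrow> n i = m (h i)"
  shows "\<exists>\<phi>. alg_iso_on sa sb (module.span sa (\<Union>i<q. unit_set n e i))
    (module.span sb (\<Union>i<q'. unit_set m e' i)) \<phi>"
proof -
  interpret A: algebra sa by fact
  interpret B: algebra sb by fact
  interpret AB: vector_space_pair sa sb ..
  let ?B = "\<Union>i<q. unit_set n e i" and ?B' = "\<Union>i<q'. unit_set m e' i"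
  have hq: "h i < q'" if "i < q" for i using h(1) that by (auto simp: bij_betw_def)
  have "\<forall>b\<in>?B. \<exists>c. \<exists>i p r. i < q \<and> p < n i \<and> r < n i \<and> b = e i p r \<and> c = e' (h i) p r"
    by (auto simp: unit_set_def)
  then obtain f where f: "\<And>b. b \<in> ?B \<Longrightarrow>
      \<exists>i p r. i < q \<and> p < n i \<and> r < n i \<and> b = e i p r \<and> f b = e' (h i) p r" by metis
  have fe: "f (e i p r) = e' (h i) p r" if "i < q" "p < n i" "r < n i" for i p r
  proof -
    have "e i p r \<in> ?B" using that by (auto simp: unit_set_def)
    from f[OF this] show ?thesis using matrix_units_inj[OF mu that] by metis
  qed
  define \<phi> where "\<phi> = AB.construct ?B f"
  have ind: "A.independent ?B" by (rule A.independent_matrix_units[OF mu])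
  have lin: "Vector_Spaces.linear sa sb \<phi>" unfolding \<phi>_def by (rule AB.linear_construct[OF ind])
  interpret \<phi>: Vector_Spaces.linear sa sb \<phi> by (rule lin)
  have \<phi>e: "\<phi> (e i p r) = e' (h i) p r" if "i < q" "p < n i" "r < n i" for i p r
  proof -
    have "e i p r \<in> ?B" using that by (auto simp: unit_set_def)
    then show ?thesis unfolding \<phi>_def by (simp add: AB.construct_basis[OF ind] fe that)
  qed
  have img: "\<phi> ` ?B = ?B'"
  proof
    show "\<phi> ` ?B \<subseteq> ?B'" using hq h(2) by (fastforce simp: unit_set_def \<phi>e)
    show "?B' \<subseteq> \<phi> ` ?B"
    proof
      fix c assume "c \<in> ?B'"
      then obtain j p r where c: "j < q'" "p < m j" "r < m j" "c = e' j p r" by (auto simp: unit_set_def)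
      then obtain i where "i < q" "j = h i" using h(1) by (auto simp: bij_betw_def)
      with c h(2) have "c = \<phi> (e i p r)" "e i p r \<in> ?B" by (auto simp: \<phi>e unit_set_def)
      then show "c \<in> \<phi> ` ?B" by blast
    qed
  qed
  have "inj_on \<phi> ?B"
  proof (rule inj_onI)
    fix x y assume "x \<in> ?B" "y \<in> ?B" "\<phi> x = \<phi> y"
    then obtain i p r i' p' r' where x: "i < q" "p < n i" "r < n i" "x = e i p r"
      and y: "i' < q" "p' < n i'" "r' < n i'" "y = e i' p' r'" by (auto simp: unit_set_def)
    then have "e' (h i) p r = e' (h i') p' r'" using \<open>\<phi> x = \<phi> y\<close> by (simp add: \<phi>e)
    then have "h i = h i' \<and> p = p' \<and> r = r'"
      using x y h(2) hq by (intro matrix_units_inj[OF mu']) auto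
    moreover from this have "i = i'" using h(1) x y by (auto simp: bij_betw_def inj_on_def)
    ultimately show "x = y" using x y by simp
  qed
  then have "inj_on \<phi> (A.span ?B)"
    using \<phi>.inj_on_span_iff_independent_image[of ?B] B.independent_matrix_units[OF mu'] img by simp
  moreover have "\<phi> ` A.span ?B = B.span ?B'" using \<phi>.span_image[of ?B] img by simp
  moreover have "\<phi> (x * y) = \<phi> x * \<phi> y" if x: "x \<in> A.span ?B" and y: "y \<in> A.span ?B" for x y
  proof -
    have base: "\<phi> (x * y) = \<phi> x * \<phi> y" if "x \<in> ?B" "y \<in> ?B" for x y
    proof -
      from that obtain i p r i' p' r' where x: "i < q" "p < n i" "r < n i" "x = e i p r"
        and y: "i' < q" "p' < n i'" "r' < n i'" "y = e i' p' r'" by (auto simp: unit_set_def)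
      have "h i = h i' \<longleftrightarrow> i = i'" using h(1) x y by (auto simp: bij_betw_def inj_on_def)
      then show ?thesis
        using x y h(2) hq
        by (auto simp: \<phi>e matrix_units_mult[OF mu] matrix_units_mult[OF mu'])
    qed
    have "A.subspace {y. \<phi> (x * y) = \<phi> x * \<phi> y}" for x
      by (auto intro!: A.subspaceI simp: \<phi>.add \<phi>.scale distrib_left A.scale_mult_right B.scale_mult_right)
    then have step: "\<phi> (x * y) = \<phi> x * \<phi> y" if "x \<in> ?B" for x
      using A.span_minimal[of ?B "{y. \<phi> (x * y) = \<phi> x * \<phi> y}"] base that y by blast
    have "A.subspace {x. \<phi> (x * y) = \<phi> x * \<phi> y}"
      by (auto intro!: A.subspaceI simp: \<phi>.add \<phi>.scale distrib_right A.scale_mult_left B.scale_mult_left)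
    then show ?thesis
      using A.span_minimal[of ?B "{x. \<phi> (x * y) = \<phi> x * \<phi> y}"] step x by blast
  qed
  ultimately have "alg_iso_on sa sb (A.span ?B) (B.span ?B') \<phi>"
    unfolding alg_iso_on_def bij_betw_def by (simp add: \<phi>.add \<phi>.scale)
  then show ?thesis by (rule exI[of _ \<phi>])
qed

lemma alg_iso_on_trans:
  assumes "alg_iso_on sa sb S T \<phi>" "alg_iso_on sb sc T U \<psi>"
  shows "alg_iso_on sa sc S U (\<psi> \<circ> \<phi>)"
proof -
  have "\<phi> x \<in> T" if "x \<in> S" for x
    using assms(1) that by (auto simp: alg_iso_on_def bij_betw_def)
  with assms show ?thesis
    unfolding alg_iso_on_def by (auto intro: bij_betw_trans)
qed

text \<open>Both subalgebras are complements of the radical, hence copies of the quotient by it: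
  \<open>\<phi>\<close> sends an element to the representative of its class in
  \<open>S'\<close>.\<close>

lemma (in fin_dim_algebra) wm_decomp_unique:
  assumes "wm_decomp sm S q C" "wm_decomp sm S' q' C'"
  shows "\<exists>\<phi>. alg_iso_on sm sm S S' \<phi>"
proof -
  let ?J = "jac sm"
  have J: "subspace ?J" "\<And>r x. x \<in> ?J \<Longrightarrow> r * x \<in> ?J" "\<And>r x. x \<in> ?J \<Longrightarrow> x * r \<in> ?J"
    using jac_nilpotent_ideal by (auto simp: ideal_in_def)
  have wmD: "subspace S \<and> (\<forall>x\<in>S. \<forall>y\<in>S. x * y \<in> S) \<and> S \<inter> ?J = {0} \<and> (\<forall>a. \<exists>s\<in>S. a - s \<in> ?J)"
    if "wm_decomp sm S q C" for S q C
  proof -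
    have "\<exists>s\<in>S. a - s \<in> ?J" for a
    proof -
      from that have "\<exists>s\<in>S. \<exists>t\<in>?J. a = s + t" unfolding wm_decomp_def by (elim conjE) blast
      then obtain s t where "s \<in> S" "t \<in> ?J" "a = s + t" by blast
      then show ?thesis by (intro bexI[of _ s]) auto
    qed
    with that show ?thesis unfolding wm_decomp_def subalg_def by (elim conjE) (intro conjI allI; assumption?; blast)
  qed
  have S: "subspace S" "S \<inter> ?J = {0}" "\<And>a. \<exists>s\<in>S. a - s \<in> ?J"
    using wmD[OF assms(1)] by auto
  have S': "subspace S'" "S' \<inter> ?J = {0}" "\<And>a. \<exists>s\<in>S'. a - s \<in> ?J"
      "\<And>x y. x \<in> S' \<Longrightarrow> y \<in> S' \<Longrightarrow> x * y \<in> S'"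
    using wmD[OF assms(2)] by auto
  have uniq: "s = t" if "subspace T" "T \<inter> ?J = {0}" "s \<in> T" "t \<in> T" "s - t \<in> ?J" for s t T
  proof -
    have "s - t \<in> T \<inter> ?J" using subspace_diff[OF that(1,3,4)] that(5) by simp
    then show ?thesis using that(2) by simp
  qed
  obtain \<phi> where \<phi>: "\<And>a. \<phi> a \<in> S'" "\<And>a. a - \<phi> a \<in> ?J" using S'(3) by metis
  have \<phi>_eq: "\<phi> a = t" if "t \<in> S'" "a - t \<in> ?J" for a t
  proof (rule uniq[OF S'(1,2) \<phi>(1) that(1)])
    show "\<phi> a - t \<in> ?J" using subspace_diff[OF J(1) that(2) \<phi>(2)[of a]] by simp
  qed
  have "bij_betw \<phi> S S'"
    unfolding bij_betw_def
  proof
    show "inj_on \<phi> S"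
    proof (rule inj_onI)
      fix x y assume xy: "x \<in> S" "y \<in> S" "\<phi> x = \<phi> y"
      then have "x - y \<in> ?J" using subspace_diff[OF J(1) \<phi>(2)[of x] \<phi>(2)[of y]] by simp
      then show "x = y" using uniq[OF S(1,2) xy(1,2)] by blast
    qed
    have "t \<in> \<phi> ` S" if t: "t \<in> S'" for t
    proof -
      obtain s where s: "s \<in> S" "t - s \<in> ?J" using S(3) by blast
      then have "s - t \<in> ?J" using subspace_neg[OF J(1) s(2)] by simp
      then have "\<phi> s = t" using \<phi>_eq t by blast
      then show ?thesis using s(1) by blast
    qed
    then show "\<phi> ` S = S'" using \<phi>(1) by blast
  qed
  moreover have "\<phi> (x + y) = \<phi> x + \<phi> y" for x y
  proof (rule \<phi>_eq)
    show "\<phi> x + \<phi> y \<in> S'" using \<phi>(1) by (intro subspace_add S')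
    have "x + y - (\<phi> x + \<phi> y) = (x - \<phi> x) + (y - \<phi> y)" by simp
    then show "x + y - (\<phi> x + \<phi> y) \<in> ?J" using \<phi>(2) by (simp only: subspace_add[OF J(1)])
  qed
  moreover have "\<phi> (x * y) = \<phi> x * \<phi> y" for x y
  proof (rule \<phi>_eq)
    show "\<phi> x * \<phi> y \<in> S'" using \<phi>(1) by (intro S')
    have "x * y - \<phi> x * \<phi> y = (x - \<phi> x) * y + \<phi> x * (y - \<phi> y)" by (simp add: algebra_simps)
    then show "x * y - \<phi> x * \<phi> y \<in> ?J" using \<phi>(2) J by (simp only: subspace_add[OF J(1)])
  qed
  moreover have "\<phi> (sm c x) = sm c (\<phi> x)" for c x
  proof (rule \<phi>_eq)
    show "sm c (\<phi> x) \<in> S'" using \<phi>(1) by (intro subspace_scale S')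
    show "sm c x - sm c (\<phi> x) \<in> ?J"
      using subspace_scale[OF J(1) \<phi>(2)[of x], of c] by (simp add: scale_right_diff_distrib)
  qed
  ultimately show ?thesis unfolding alg_iso_on_def by blast
qed

theorem theorem1p2:
  fixes sa :: "'k::field_char_0 \<Rightarrow> 'a::ring \<Rightarrow> 'a"
    and sb :: "'k \<Rightarrow> 'b::ring \<Rightarrow> 'b"
  assumes "alg_closed_field TYPE('k)"
    and "fd_algebra sa" and "fd_algebra sb"
    and "full_alg sa" and "full_alg sb"
    and "PI_Id sa = PI_Id sb"
    and "wm_decomp sa SA qa CA" and "wm_decomp sb SB qb CB"
  shows "\<exists>\<phi>. alg_iso_on sa sb SA SB \<phi>"
proof -
  obtain Ba Bb where "fin_dim_algebra sa Ba" "fin_dim_algebra sb Bb"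
    using fd_algebra_imp_fin_dim_algebra assms(2,3) by metis
  interpret A: fin_dim_algebra sa Ba by fact
  interpret B: fin_dim_algebra sb Bb by fact
  \<comment> \<open>Fullness is witnessed by some decomposition, perhaps not the given one. The
    witnesses are compared first, and \<open>wm_decomp_unique\<close> then moves the result to
    \<open>SA\<close> and \<open>SB\<close>.\<close>
  obtain S q C a j where A: "wm_decomp sa S q C" "q \<ge> 1" "\<forall>i<q. a i \<in> C i" "jprod a j q \<noteq> 0"
    using assms(4) unfolding full_alg_def by blast
  obtain n e where mu: "matrix_units q n e" "\<forall>i<q. C i = A.span (unit_set n e i)"
      "S = A.span (\<Union>i<q. unit_set n e i)"
    using A.wm_decomp_matrix_units[OF assms(1) A(1)] by blast
  obtain S' q' C' a' j' where B: "wm_decomp sb S' q' C'" "q' \<ge> 1" "\<forall>i<q'. a' i \<in> C' i" "jprod a' j' q' \<noteq> 0"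
    using assms(5) unfolding full_alg_def by blast
  obtain m e' where mu': "matrix_units q' m e'" "\<forall>i<q'. C' i = B.span (unit_set m e' i)"
      "S' = B.span (\<Union>i<q'. unit_set m e' i)"
    using B.wm_decomp_matrix_units[OF assms(1) B(1)] by blast
  obtain h where h: "\<forall>i<q. h i < q'" "\<forall>j<q'. (\<Sum>i | i < q \<and> h i = j. n i * n i) \<le> m j * m j"
    using full_component_sizes[OF A.algebra_axioms B.fin_dim_algebra_axioms _ mu(1) _ _ A(4) mu'(1) B(1) mu'(3)]
      assms(6) A(2,3) mu(2) by auto
  obtain h' where h': "\<forall>j<q'. h' j < q" "\<forall>i<q. (\<Sum>j | j < q' \<and> h' j = i. m j * m j) \<le> n i * n i"
    using full_component_sizes[OF B.algebra_axioms A.fin_dim_algebra_axioms _ mu'(1) _ _ B(4) mu(1) A(1) mu(3)]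
      assms(6) B(2,3) mu'(2) by auto
  have "bij_betw h {..<q} {..<q'} \<and> (\<forall>i<q. n i = m (h i))"
    using mu(1) mu'(1) by (intro component_matching[OF h h']) (auto simp: matrix_units_def)
  then obtain \<psi> where \<psi>: "alg_iso_on sa sb S S' \<psi>"
    using matrix_units_iso[OF A.algebra_axioms B.algebra_axioms mu(1) mu'(1)] mu(3) mu'(3) by auto
  obtain \<alpha> where \<alpha>: "alg_iso_on sa sa SA S \<alpha>" using A.wm_decomp_unique[OF assms(7) A(1)] by blast
  obtain \<beta> where \<beta>: "alg_iso_on sb sb S' SB \<beta>" using B.wm_decomp_unique[OF B(1) assms(8)] by blast
  show ?thesis
    using alg_iso_on_trans[OF alg_iso_on_trans[OF \<alpha> \<psi>] \<beta>] by blast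
qed

end
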